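(* Let $K$ be a field, let $k\ge 2$ be an integer, and let $a,d\in\mathbb{N}^2$ be linearly independent over $\mathbb{Q}$ such that $\{a,a+d,\ldots,a+kd\}$ is a minimal generating set of $S_{a,d,k}=\langle a,a+d,\ldots,a+kd\rangle$. Then the Castelnuovo-Mumford regularity of $K[S_{a,d,k}]$ is $1$.
   Context: $\mathbb{N}$ denotes the set of non-negative integers. $\langle a_1,\ldots,a_n\rangle=\{\sum_i\lambda_i a_i\mid \lambda_i\in\mathbb{N}\}$ is the affine semigroup generated by $a_1,\ldots,a_n\in\mathbb{N}^r$. $K[S]=\bigoplus_{s\in S}K\mathbf{t}^s\subseteq K[t_1,\ldots,t_r]$ is the semigroup ring of $S$. $K[S_{a,d,k}]$ is viewed as the graded module $R/I_{S_{a,d,k}}$ over $R=K[x_1,\ldots,x_{k+1}]$ with the standard grading $\deg x_i=1$, where $I_{S_{a,d,k}}$ is the kernel of $x_i\mapsto\mathbf{t}^{a+(i-1)d}$ (a homogeneous ideal for the standard grading). The regularity of a finitely generated graded $R$-module $M$ is $\max_i\{t_i-i\}$, where $t_i$ is the maximal degree of a generator of the $i$-th module in the minimal graded free resolution of $M$ over $R$. *)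

theory Defs
  imports "HOL-Analysis.Cartesian_Space" "HOL-Algebra.QuotRing" "HOL-Algebra.Module"
    "HOL-Library.Poly_Mapping"
begin

section \<open>Affine semigroups and semigroup rings\<close>

definition affine_semigroup :: "(nat ^ 'r) set \<Rightarrow> (nat ^ 'r::finite) set" where
  "affine_semigroup A = {\<Sum>v\<in>A. c v *s v | c. True}"

definition minimal_generating_set :: "(nat ^ 'r) set \<Rightarrow> (nat ^ 'r::finite) set \<Rightarrow> bool" where
  "minimal_generating_set A S \<longleftrightarrow>
     finite A \<and> affine_semigroup A = S \<and> (\<forall>B. B \<subset> A \<longrightarrow> affine_semigroup B \<noteq> S)"

text \<open>Two vectors are linearly independent over the rationals.  The clause \<open>a \<noteq> d\<close> is
  needed because \<^const>\<open>module.dependent\<close> is a property of the set \<open>{a, d}\<close>, which collapses to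
  a singleton if \<open>a = d\<close>.\<close>

definition rat_vec :: "nat ^ 'r \<Rightarrow> rat ^ 'r::finite" where
  "rat_vec v = (\<chi> i. of_nat (v $ i))"

definition lin_indep_over_rat :: "nat ^ 'r::finite \<Rightarrow> nat ^ 'r \<Rightarrow> bool" where
  "lin_indep_over_rat a d \<longleftrightarrow> a \<noteq> d \<and> vec.independent {rat_vec a, rat_vec d}"

text \<open>The type \<open>(nat ^ 'r) \<Rightarrow>\<^sub>0 'k\<close> with the convolution product is the polynomial ring
  \<open>K[t\<^sub>1, \<dots>, t\<^sub>r]\<close>; the key \<open>s\<close> stands for the monomial with exponent vector \<open>s\<close>.\<close>

definition semigroup_ring :: "(nat ^ 'r::finite) set \<Rightarrow> ((nat ^ 'r) \<Rightarrow>\<^sub>0 'k::field) ring" where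
  "semigroup_ring S =
     \<lparr>carrier = {f. Poly_Mapping.keys f \<subseteq> S}, mult = (*), one = 1, zero = 0, add = (+)\<rparr>"


section \<open>Polynomial rings and toric ideals\<close>

text \<open>A monomial is a finitely supported exponent function \<open>nat \<Rightarrow>\<^sub>0 nat\<close>.  The ring
  \<open>mpoly_ring n\<close> is the polynomial ring in the \<open>n\<close> variables with indices \<open>0, \<dots>, n - 1\<close>.\<close>

type_synonym 'k mpoly = "(nat \<Rightarrow>\<^sub>0 nat) \<Rightarrow>\<^sub>0 'k"

definition mpoly_ring :: "nat \<Rightarrow> 'k::field mpoly ring" where
  "mpoly_ring n =
     \<lparr>carrier = {p. \<forall>m\<in>Poly_Mapping.keys p. Poly_Mapping.keys m \<subseteq> {..<n}},
      mult = (*), one = 1, zero = 0, add = (+)\<rparr>"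

definition total_degree :: "(nat \<Rightarrow>\<^sub>0 nat) \<Rightarrow> nat" where
  "total_degree m = (\<Sum>i\<in>Poly_Mapping.keys m. Poly_Mapping.lookup m i)"

text \<open>The homogeneous component of degree \<open>j\<close> in the standard grading (zero for negative \<open>j\<close>).\<close>

definition mpoly_deg :: "nat \<Rightarrow> int \<Rightarrow> 'k::field mpoly set" where
  "mpoly_deg n j =
     {p \<in> carrier (mpoly_ring n). \<forall>m\<in>Poly_Mapping.keys p. int (total_degree m) = j}"

definition irrelevant_ideal :: "nat \<Rightarrow> 'k::field mpoly set" where
  "irrelevant_ideal n =
     Idl\<^bsub>mpoly_ring n\<^esub> {Poly_Mapping.single (Poly_Mapping.single i 1) 1 | i. i < n}"

text \<open>The substitution \<open>x\<^sub>i \<mapsto> t\<^bsup>g i\<^esup>\<close>.\<close>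

definition toric_map :: "(nat \<Rightarrow> nat ^ 'r::finite) \<Rightarrow> 'k::field mpoly \<Rightarrow> (nat ^ 'r) \<Rightarrow>\<^sub>0 'k" where
  "toric_map g p =
     (\<Sum>m\<in>Poly_Mapping.keys p. Poly_Mapping.single 0 (Poly_Mapping.lookup p m) *
        (\<Prod>i\<in>Poly_Mapping.keys m. Poly_Mapping.single (g i) 1 ^ Poly_Mapping.lookup m i))"

definition toric_ideal :: "nat \<Rightarrow> (nat \<Rightarrow> nat ^ 'r::finite) \<Rightarrow> 'k::field mpoly set" where
  "toric_ideal n g =
     a_kernel (mpoly_ring n) (semigroup_ring (affine_semigroup (g ` {..<n}))) (toric_map g)"


section \<open>Graded modules over a polynomial ring\<close>

text \<open>A grading of a module is given by the family of its homogeneous components.  The fields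
  \<^const>\<open>mult\<close> and \<^const>\<open>one\<close> of the record of a module play no role.\<close>

definition graded_module ::
  "nat \<Rightarrow> ('k::field mpoly, 'm) module \<Rightarrow> (int \<Rightarrow> 'm set) \<Rightarrow> bool" where
  "graded_module n M Mdeg \<longleftrightarrow>
     Module.module (mpoly_ring n) M \<and>
     (\<forall>i. additive_subgroup (Mdeg i) M) \<and>
     (\<forall>i j. \<forall>p \<in> mpoly_deg n i. \<forall>x \<in> Mdeg j. p \<odot>\<^bsub>M\<^esub> x \<in> Mdeg (i + j)) \<and>
     (\<forall>x \<in> carrier M. \<exists>!c. (\<forall>i. c i \<in> Mdeg i) \<and> finite {i. c i \<noteq> \<zero>\<^bsub>M\<^esub>} \<and>
        x = (\<Oplus>\<^bsub>M\<^esub>i\<in>{i. c i \<noteq> \<zero>\<^bsub>M\<^esub>}. c i))"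

text \<open>Homogeneous module homomorphisms of degree \<open>0\<close>.\<close>

definition graded_hom ::
  "nat \<Rightarrow> ('k::field mpoly, 'm) module \<Rightarrow> (int \<Rightarrow> 'm set) \<Rightarrow>
   ('k mpoly, 'n) module \<Rightarrow> (int \<Rightarrow> 'n set) \<Rightarrow> ('m \<Rightarrow> 'n) set" where
  "graded_hom n M Mdeg N Ndeg =
     {f. f \<in> carrier M \<rightarrow> carrier N \<and>
         (\<forall>x\<in>carrier M. \<forall>y\<in>carrier M. f (x \<oplus>\<^bsub>M\<^esub> y) = f x \<oplus>\<^bsub>N\<^esub> f y) \<and>
         (\<forall>p\<in>carrier (mpoly_ring n). \<forall>x\<in>carrier M. f (p \<odot>\<^bsub>M\<^esub> x) = p \<odot>\<^bsub>N\<^esub> f x) \<and>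
         (\<forall>j. f ` Mdeg j \<subseteq> Ndeg j)}"

text \<open>The graded free module with one basis element of degree \<open>e\<close> for each entry \<open>e\<close> of the
  list \<open>es\<close>.  Its elements are coordinate vectors, padded by \<open>0\<close>.\<close>

definition free_mod :: "nat \<Rightarrow> int list \<Rightarrow> ('k::field mpoly, nat \<Rightarrow> 'k mpoly) module" where
  "free_mod n es =
     \<lparr>carrier = {v. (\<forall>j<length es. v j \<in> carrier (mpoly_ring n)) \<and> (\<forall>j\<ge>length es. v j = 0)},
      mult = (\<lambda>u v j. u j * v j), one = (\<lambda>j. if j < length es then 1 else 0),
      zero = (\<lambda>j. 0), add = (\<lambda>u v j. u j + v j), smult = (\<lambda>p v j. p * v j)\<rparr>"

definition free_mod_deg :: "nat \<Rightarrow> int list \<Rightarrow> int \<Rightarrow> (nat \<Rightarrow> 'k::field mpoly) set" where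
  "free_mod_deg n es i =
     {v \<in> carrier (free_mod n es). \<forall>j<length es. v j \<in> mpoly_deg n (i - es ! j)}"

text \<open>A minimal graded free resolution
  \<open>\<dots> \<rightarrow> F\<^sub>2 \<rightarrow> F\<^sub>1 \<rightarrow> F\<^sub>0 \<rightarrow> M \<rightarrow> 0\<close>, where \<open>es i\<close> lists the degrees of the generators
  of \<open>F\<^sub>i\<close>, \<open>\<delta> i\<close> is the map from \<open>F\<^sub>i\<^sub>+\<^sub>1\<close> to \<open>F\<^sub>i\<close>, and \<open>\<epsilon>\<close> is the augmentation.
  The last clause is minimality: the image of \<open>\<delta> i\<close> lies in \<open>\<mm>F\<^sub>i\<close>, where \<open>\<mm>\<close> is the
  irrelevant ideal.\<close>

definition minimal_graded_free_resolution ::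
  "nat \<Rightarrow> ('k::field mpoly, 'm) module \<Rightarrow> (int \<Rightarrow> 'm set) \<Rightarrow> (nat \<Rightarrow> int list) \<Rightarrow>
   ((nat \<Rightarrow> 'k mpoly) \<Rightarrow> 'm) \<Rightarrow> (nat \<Rightarrow> (nat \<Rightarrow> 'k mpoly) \<Rightarrow> (nat \<Rightarrow> 'k mpoly)) \<Rightarrow> bool" where
  "minimal_graded_free_resolution n M Mdeg es \<epsilon> \<delta> \<longleftrightarrow>
     graded_module n M Mdeg \<and>
     \<epsilon> \<in> graded_hom n (free_mod n (es 0)) (free_mod_deg n (es 0)) M Mdeg \<and>
     (\<forall>i. \<delta> i \<in> graded_hom n (free_mod n (es (Suc i))) (free_mod_deg n (es (Suc i)))
                               (free_mod n (es i)) (free_mod_deg n (es i))) \<and>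
     \<epsilon> ` carrier (free_mod n (es 0)) = carrier M \<and>
     a_kernel (free_mod n (es 0)) M \<epsilon> = \<delta> 0 ` carrier (free_mod n (es 1)) \<and>
     (\<forall>i. a_kernel (free_mod n (es (Suc i))) (free_mod n (es i)) (\<delta> i) =
            \<delta> (Suc i) ` carrier (free_mod n (es (Suc (Suc i))))) \<and>
     (\<forall>i. \<forall>v \<in> carrier (free_mod n (es (Suc i))). \<forall>j<length (es i).
        \<delta> i v j \<in> irrelevant_ideal n)"

text \<open>The modules \<open>F\<^sub>i = 0\<close> do not contribute to the maximum, which is over a finite set by
  Hilbert's syzygy theorem; minimal graded free resolutions are isomorphic, so \<open>r\<close> is unique.\<close>

definition regularity :: "nat \<Rightarrow> ('k::field mpoly, 'm) module \<Rightarrow> (int \<Rightarrow> 'm set) \<Rightarrow> int" where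
  "regularity n M Mdeg =
     (THE r. \<exists>es \<epsilon> \<delta>. minimal_graded_free_resolution n M Mdeg es \<epsilon> \<delta> \<and>
        r = Max {Max (set (es i)) - int i | i. es i \<noteq> []})"


section \<open>The semigroup ring as a graded module\<close>

definition quotient_module :: "nat \<Rightarrow> 'k::field mpoly set \<Rightarrow> ('k mpoly, 'k mpoly set) module" where
  "quotient_module n I =
     \<lparr>carrier = carrier (mpoly_ring n Quot I), mult = mult (mpoly_ring n Quot I),
      one = \<one>\<^bsub>mpoly_ring n Quot I\<^esub>, zero = \<zero>\<^bsub>mpoly_ring n Quot I\<^esub>,
      add = add (mpoly_ring n Quot I),
      smult = (\<lambda>p X. (I +>\<^bsub>mpoly_ring n\<^esub> p) \<otimes>\<^bsub>mpoly_ring n Quot I\<^esub> X)\<rparr>"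

definition quotient_deg :: "nat \<Rightarrow> 'k::field mpoly set \<Rightarrow> int \<Rightarrow> 'k mpoly set set" where
  "quotient_deg n I j = (\<lambda>p. I +>\<^bsub>mpoly_ring n\<^esub> p) ` mpoly_deg n j"

text \<open>The generators \<open>a, a + d, \<dots>, a + kd\<close>, indexed from \<open>0\<close>.\<close>

definition arith_gen :: "nat ^ 'r::finite \<Rightarrow> nat ^ 'r \<Rightarrow> nat \<Rightarrow> nat ^ 'r" where
  "arith_gen a d i = a + i *s d"

definition arith_semigroup :: "nat ^ 'r::finite \<Rightarrow> nat ^ 'r \<Rightarrow> nat \<Rightarrow> (nat ^ 'r) set" where
  "arith_semigroup a d k = affine_semigroup (arith_gen a d ` {..k})"

text \<open>The regularity of \<open>K[S]\<close> for \<open>S = arith_semigroup a d k\<close>, as the graded module \<open>R/I\<close>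
  over the polynomial ring \<open>R\<close> in \<open>k + 1\<close> variables.\<close>

definition arith_semigroup_ring_regularity ::
  "'k::field itself \<Rightarrow> nat ^ 'r::finite \<Rightarrow> nat ^ 'r \<Rightarrow> nat \<Rightarrow> int" where
  "arith_semigroup_ring_regularity K a d k =
     (let I = (toric_ideal (k + 1) (arith_gen a d) :: 'k mpoly set)
      in regularity (k + 1) (quotient_module (k + 1) I) (quotient_deg (k + 1) I))"


section \<open>The quotient by the toric ideal is the semigroup ring\<close>

lemma support_cring:
  fixes S :: "'a::comm_monoid_add set"
  assumes S: "0 \<in> S" "\<And>x y. x \<in> S \<Longrightarrow> y \<in> S \<Longrightarrow> x + y \<in> S"
  shows "cring \<lparr>carrier = {f :: 'a \<Rightarrow>\<^sub>0 'k::field. Poly_Mapping.keys f \<subseteq> S},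
           mult = (*), one = 1, zero = 0, add = (+)\<rparr>"
proof (rule cringI)
  let ?R = "\<lparr>carrier = {f :: 'a \<Rightarrow>\<^sub>0 'k::field. Poly_Mapping.keys f \<subseteq> S}, mult = (*), one = 1, zero = 0, add = (+)\<rparr>"
  have um: "Poly_Mapping.keys (- p) = Poly_Mapping.keys p" for p :: "'a \<Rightarrow>\<^sub>0 'k"
    by (auto simp: in_keys_iff)
  show "abelian_group ?R"
  proof (rule abelian_groupI)
    fix x assume "x \<in> carrier ?R"
    then show "\<exists>y\<in>carrier ?R. y \<oplus>\<^bsub>?R\<^esub> x = \<zero>\<^bsub>?R\<^esub>"
      by (intro bexI[of _ "- x"]) (auto simp: um)
  qed (use S in \<open>auto simp: add_ac dest!: subsetD[OF Poly_Mapping.keys_add]\<close>)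
  show "Group.comm_monoid ?R"
    by (rule comm_monoidI) (use S in \<open>auto simp: mult_ac dest!: subsetD[OF Poly_Mapping.keys_mult]\<close>)
qed (auto simp: algebra_simps)

lemma mpoly_ring_cring: "cring (mpoly_ring n :: 'k::field mpoly ring)"
proof -
  have "cring \<lparr>carrier = {f :: 'k mpoly. Poly_Mapping.keys f \<subseteq> {m. Poly_Mapping.keys m \<subseteq> {..<n}}},
          mult = (*), one = 1, zero = 0, add = (+)\<rparr>"
    by (rule support_cring) (auto dest!: subsetD[OF Poly_Mapping.keys_add])
  then show ?thesis
    unfolding mpoly_ring_def by (simp add: subset_iff Ball_def)
qed

lemma Suc_smult_vec: "Suc e *s v = v + e *s (v :: nat ^ 'r)" "Suc 0 *s v = v"
  by (simp_all add: vec_eq_iff)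

lemma affine_semigroup_0: "0 \<in> affine_semigroup A"
  unfolding affine_semigroup_def by (auto intro!: exI[of _ "\<lambda>_. 0"])

lemma affine_semigroup_add:
  "x \<in> affine_semigroup A \<Longrightarrow> y \<in> affine_semigroup A \<Longrightarrow> x + y \<in> affine_semigroup A"
proof -
  assume "x \<in> affine_semigroup A" "y \<in> affine_semigroup A"
  then obtain c c' where "x = (\<Sum>v\<in>A. c v *s v)" "y = (\<Sum>v\<in>A. c' v *s v)"
    by (auto simp: affine_semigroup_def)
  then have "x + y = (\<Sum>v\<in>A. (c v + c' v) *s v)"
    by (simp add: sum.distrib vector_sadd_rdistrib)
  then show ?thesis unfolding affine_semigroup_def
    by (intro CollectI exI[of _ "\<lambda>v. c v + c' v"]) auto
qed

lemma affine_semigroup_gen: "finite A \<Longrightarrow> v \<in> A \<Longrightarrow> v \<in> affine_semigroup A"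
  unfolding affine_semigroup_def
  by (intro CollectI exI[of _ "\<lambda>w. if w = v then 1 else 0"])
     (auto simp: if_distrib[of "\<lambda>c. c *s _"] sum.delta' Suc_smult_vec cong: if_cong)

lemma semigroup_ring_cring: "cring (semigroup_ring (affine_semigroup A) :: ((nat ^ 'r::finite) \<Rightarrow>\<^sub>0 'k::field) ring)"
  unfolding semigroup_ring_def by (rule support_cring) (auto intro: affine_semigroup_0 affine_semigroup_add)

definition toric_mon :: "(nat \<Rightarrow> nat ^ 'r::finite) \<Rightarrow> (nat \<Rightarrow>\<^sub>0 nat) \<Rightarrow> (nat ^ 'r) \<Rightarrow>\<^sub>0 'k::field" where
 "toric_mon g m = (\<Prod>i\<in>Poly_Mapping.keys m. Poly_Mapping.single (g i) 1 ^ Poly_Mapping.lookup m i)"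

lemma toric_mon_superset: "finite A \<Longrightarrow> Poly_Mapping.keys m \<subseteq> A \<Longrightarrow> toric_mon g m = (\<Prod>i\<in>A. Poly_Mapping.single (g i) 1 ^ Poly_Mapping.lookup m i)"
  unfolding toric_mon_def by (rule prod.mono_neutral_left) (auto simp: in_keys_iff)

lemma toric_mon_add: "toric_mon g (m + m') = toric_mon g m * toric_mon g m'"
proof -
  let ?A = "Poly_Mapping.keys m \<union> Poly_Mapping.keys m'"
  show ?thesis
    by (subst (1 2 3) toric_mon_superset[of ?A]) (auto simp: lookup_add power_add prod.distrib dest!: subsetD[OF Poly_Mapping.keys_add])
qed

lemma toric_map_add: "toric_map g (p + q) = toric_map g p + toric_map g q"
  unfolding toric_map_def toric_mon_def[symmetric]
  by (rule setsum_keys_plus_distrib) (simp_all add: single_add algebra_simps)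

lemma toric_map_zero: "toric_map g 0 = 0" by (simp add: toric_map_def)

lemma toric_map_one: "toric_map g 1 = 1" by (simp add: toric_map_def)

lemma toric_map_sum: "toric_map g (sum f A) = (\<Sum>x\<in>A. toric_map g (f x))"
  by (induction A rule: infinite_finite_induct) (auto simp: toric_map_add toric_map_zero)

lemma toric_map_single: "toric_map g (Poly_Mapping.single m c) = Poly_Mapping.single 0 c * toric_mon g m"
  by (simp add: toric_map_def toric_mon_def)

lemma poly_mapping_eq_sum_single: "p = (\<Sum>m\<in>Poly_Mapping.keys p. Poly_Mapping.single m (Poly_Mapping.lookup p m))"
  by (rule poly_mapping_eqI) (auto simp: lookup_sum lookup_single when_def in_keys_iff sum.delta' )

lemma toric_map_mult: "toric_map g (p * q) = toric_map g p * toric_map g q"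
proof -
  have "toric_map g (p * q) = toric_map g ((\<Sum>m\<in>Poly_Mapping.keys p. Poly_Mapping.single m (Poly_Mapping.lookup p m)) * (\<Sum>m\<in>Poly_Mapping.keys q. Poly_Mapping.single m (Poly_Mapping.lookup q m)))"
    by (rule arg_cong[OF arg_cong2[OF poly_mapping_eq_sum_single poly_mapping_eq_sum_single]])
  also have "\<dots> = (\<Sum>m\<in>Poly_Mapping.keys p. \<Sum>m'\<in>Poly_Mapping.keys q.
     (Poly_Mapping.single 0 (Poly_Mapping.lookup p m) * toric_mon g m) * (Poly_Mapping.single 0 (Poly_Mapping.lookup q m') * toric_mon g m'))"
    unfolding sum_product toric_map_sum mult_single toric_map_single toric_mon_add
    by (intro sum.cong refl) (simp add: mult_ac mult_single flip: mult.assoc)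
  also have "\<dots> = toric_map g p * toric_map g q"
    unfolding toric_map_def toric_mon_def[symmetric] sum_product ..
  finally show ?thesis .
qed

lemma single_power: "(Poly_Mapping.single v 1 :: (nat^'r) \<Rightarrow>\<^sub>0 'k::field) ^ e = Poly_Mapping.single (e *s v) 1"
  by (induction e) (auto simp: mult_single Suc_smult_vec)

lemma toric_mon_eq: "toric_mon g m = (Poly_Mapping.single (\<Sum>i\<in>Poly_Mapping.keys m. Poly_Mapping.lookup m i *s g i) 1 :: (nat^'r::finite) \<Rightarrow>\<^sub>0 'k::field)"
proof -
  have "(\<Prod>i\<in>A. Poly_Mapping.single (h i) 1) = (Poly_Mapping.single (sum h A) 1 :: (nat^'r::finite) \<Rightarrow>\<^sub>0 'k::field)" if "finite A" for h :: "nat \<Rightarrow> nat^'r" and A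
    using that by induction (auto simp: mult_single)
  then show ?thesis unfolding toric_mon_def single_power by simp
qed

lemma affine_semigroup_smult: "v \<in> affine_semigroup A \<Longrightarrow> (e::nat) *s v \<in> affine_semigroup A"
  by (induction e) (auto simp: Suc_smult_vec intro: affine_semigroup_0 affine_semigroup_add)

lemma affine_semigroup_sum: "(\<And>i. i \<in> I \<Longrightarrow> h i \<in> affine_semigroup A) \<Longrightarrow> sum h I \<in> affine_semigroup A"
  by (induction I rule: infinite_finite_induct) (auto intro: affine_semigroup_0 affine_semigroup_add)

lemma toric_map_hom:
  "(toric_map g :: 'k::field mpoly \<Rightarrow> (nat ^ 'r::finite) \<Rightarrow>\<^sub>0 'k)
     \<in> ring_hom (mpoly_ring n) (semigroup_ring (affine_semigroup (g ` {..<n})))"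
proof (rule ring_hom_memI)
  fix p :: "'k mpoly" assume p: "p \<in> carrier (mpoly_ring n)"
  have "Poly_Mapping.keys (Poly_Mapping.single 0 (Poly_Mapping.lookup p m) * toric_mon g m) \<subseteq> affine_semigroup (g ` {..<n})"
    if "m \<in> Poly_Mapping.keys p" for m
    using p that unfolding toric_mon_eq mult_single
    by (auto simp: mpoly_ring_def intro!: affine_semigroup_sum affine_semigroup_smult affine_semigroup_gen)
  then show "toric_map g p \<in> carrier (semigroup_ring (affine_semigroup (g ` {..<n})))"
    unfolding toric_map_def toric_mon_def[symmetric] semigroup_ring_def
    using keys_sum[of "\<lambda>m. Poly_Mapping.single 0 (Poly_Mapping.lookup p m) * toric_mon g m" "Poly_Mapping.keys p"]
    by (force dest!: subsetD)
qed (auto simp: mpoly_ring_def semigroup_ring_def toric_map_add toric_map_mult toric_map_one)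

lemma toric_map_surj:
  "toric_map g ` carrier (mpoly_ring n) = carrier (semigroup_ring (affine_semigroup (g ` {..<n})) :: ((nat^'r::finite) \<Rightarrow>\<^sub>0 'k::field) ring)"
proof (intro antisym subsetI)
  fix f :: "(nat^'r) \<Rightarrow>\<^sub>0 'k" assume f: "f \<in> carrier (semigroup_ring (affine_semigroup (g ` {..<n})))"
  let ?I = "toric_map g ` carrier (mpoly_ring n) :: ((nat^'r) \<Rightarrow>\<^sub>0 'k) set"
  interpret R: cring "mpoly_ring n :: 'k mpoly ring" by (rule mpoly_ring_cring)
  have I_add: "x + y \<in> ?I" if xy: "x \<in> ?I" "y \<in> ?I" for x y
  proof -
    obtain p q where "x = toric_map g p" "y = toric_map g q" "p \<in> carrier (mpoly_ring n)" "q \<in> carrier (mpoly_ring n)"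
      using xy by blast
    then show ?thesis using R.a_closed[of p q] by (intro image_eqI[of _ _ "p + q"]) (auto simp: toric_map_add mpoly_ring_def)
  qed
  have I_mult: "x * y \<in> ?I" if xy: "x \<in> ?I" "y \<in> ?I" for x y
  proof -
    obtain p q where "x = toric_map g p" "y = toric_map g q" "p \<in> carrier (mpoly_ring n)" "q \<in> carrier (mpoly_ring n)"
      using xy by blast
    then show ?thesis using R.m_closed[of p q] by (intro image_eqI[of _ _ "p * q"]) (auto simp: toric_map_mult mpoly_ring_def)
  qed
  have I_const: "Poly_Mapping.single 0 c \<in> ?I" for c
    by (intro image_eqI[of _ _ "Poly_Mapping.single 0 c"]) (auto simp: toric_map_single toric_mon_def mpoly_ring_def)
  have I_gen: "Poly_Mapping.single (g i) 1 \<in> ?I" if "i < n" for i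
    using that by (intro image_eqI[of _ _ "Poly_Mapping.single (Poly_Mapping.single i 1) 1"]) (auto simp: toric_map_single toric_mon_def mpoly_ring_def)
  have I_smult: "Poly_Mapping.single (e *s v) 1 \<in> ?I" if "Poly_Mapping.single v 1 \<in> ?I" for e v
    using that unfolding single_power[symmetric] by (induction e) (auto intro: I_mult I_const[of 1, simplified])
  have I_sum: "Poly_Mapping.single (sum h A) 1 \<in> ?I" if "\<And>v. v \<in> A \<Longrightarrow> Poly_Mapping.single (h v) 1 \<in> ?I" for h A
    using that
  proof (induction A rule: infinite_finite_induct)
    case (insert x A)
    then show ?case using I_mult[of "Poly_Mapping.single (h x) 1" "Poly_Mapping.single (sum h A) 1"] by (simp add: mult_single)
  qed (use I_const[of 1] in auto)
  have I_mono: "Poly_Mapping.single v c \<in> ?I" if "v \<in> affine_semigroup (g ` {..<n})" for v c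
  proof -
    have "Poly_Mapping.single v 1 \<in> ?I"
      using that unfolding affine_semigroup_def by (auto intro!: I_sum I_smult I_gen)
    from I_mult[OF I_const[of c] this] show ?thesis by (simp add: mult_single)
  qed
  have "(\<Sum>v\<in>A. Poly_Mapping.single v (Poly_Mapping.lookup f v)) \<in> ?I" if "A \<subseteq> Poly_Mapping.keys f" for A
    using finite_subset[OF that finite_keys] that f
    by (induction A) (auto intro!: I_add I_mono I_const[of 0, simplified] simp: semigroup_ring_def)
  then show "f \<in> ?I" using poly_mapping_eq_sum_single[of f] by (metis subset_refl)
next
  fix f :: "(nat^'r) \<Rightarrow>\<^sub>0 'k" assume "f \<in> toric_map g ` carrier (mpoly_ring n)"
  then show "f \<in> carrier (semigroup_ring (affine_semigroup (g ` {..<n})))"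
    using ring_hom_memE(1)[OF toric_map_hom] by blast
qed


lemma quotient_iso_semigroup_ring:
  fixes g :: "nat \<Rightarrow> nat ^ 'r::finite"
  shows "((mpoly_ring n :: 'k mpoly ring) Quot toric_ideal n g) \<simeq>
     (semigroup_ring (affine_semigroup (g ` {..<n})) :: ((nat ^ 'r) \<Rightarrow>\<^sub>0 'k::field) ring)"
proof -
  interpret ring_hom_ring "mpoly_ring n :: 'k mpoly ring"
    "semigroup_ring (affine_semigroup (g ` {..<n})) :: ((nat ^ 'r) \<Rightarrow>\<^sub>0 'k) ring" "toric_map g"
    by (intro ring_hom_ringI2 toric_map_hom cring.axioms(1) mpoly_ring_cring semigroup_ring_cring)
  show ?thesis unfolding toric_ideal_def by (rule FactRing_iso[OF toric_map_surj])
qed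

end

theory Submission
  imports Defs "HOL-Library.Function_Algebras"
begin

text \<open>Linear independence of \<open>a\<close> and \<open>d\<close> means that the exponent of the image of a monomial
determines its degree \<open>p\<close> and its weight \<open>q\<close> (the sum of its indices), so \<open>S\<close> consists of the
vectors \<open>p a + q d\<close> with \<open>q \<le> k p\<close>, and the toric ideal \<open>I\<close> is that of the rational normal curve
of degree \<open>k\<close>.  Two facts about \<open>K[S] = R/I\<close> force its regularity to be at most \<open>1\<close>: the
variables \<open>x\<^sub>0, x\<^sub>k\<close> form a regular sequence on it, and every monomial of degree at least \<open>2\<close> is a
multiple of \<open>x\<^sub>0\<close> or \<open>x\<^sub>k\<close> modulo \<open>I\<close>.

Tor and Koszul homology are avoided by a criterion in the spirit of Bayer and Stillman.  Fix an
order \<open>y\<^sub>1, \<dots>, y\<^sub>n\<close> of the variables.  Call a graded module \<open>M\<close> regular beyond \<open>r\<close> if in degrees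
greater than \<open>r\<close> multiplication by each \<open>y\<^sub>s\<^sub>+\<^sub>1\<close> on \<open>M/(y\<^sub>1, \<dots>, y\<^sub>s)M\<close> has zero kernel and
\<open>M = (y\<^sub>1, \<dots>, y\<^sub>n)M\<close>.  With the order \<open>x\<^sub>0, x\<^sub>k, x\<^sub>1, \<dots>, x\<^sub>k\<^sub>-\<^sub>1\<close> the two facts say that \<open>R/I\<close> is
regular beyond \<open>1\<close> (lemma \<open>quot_regular_I_vec\<close>).  If \<open>F\<close> is free with generators of degree at
most \<open>r\<close> and \<open>F/N\<close> is regular beyond \<open>r\<close>, then \<open>N\<close> is regular beyond \<open>r + 1\<close> (lemma
\<open>sub_regular_of_quot_regular\<close>); the point is that
\<open>N \<inter> (y\<^sub>1, \<dots>, y\<^sub>s)F = (y\<^sub>1, \<dots>, y\<^sub>s)N\<close> in degrees greater than \<open>r + 1\<close>, which is the vanishing of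
\<open>Tor\<^sub>1(R/(y\<^sub>1, \<dots>, y\<^sub>s), F/N)\<close> there.

A module that is regular beyond \<open>r\<close> and vanishes below degree \<open>r\<close> is called linear here.  By
Nakayama's argument a minimal cover of it by a free module has all its generators in degree \<open>r\<close>,
and the kernel is linear for \<open>r + 1\<close>.  Since \<open>I\<close> contains no nonzero form of degree less than
\<open>2\<close>, it is linear for \<open>r = 2\<close>.  Hence in every minimal resolution of \<open>R/I\<close> the module \<open>F\<^sub>0\<close> is
\<open>R\<close> and each \<open>F\<^sub>i\<close> with \<open>i \<ge> 1\<close> is a sum of copies of \<open>R(- i - 1)\<close>; moreover \<open>F\<^sub>1\<close> is not zero
because \<open>x\<^sub>0 x\<^sub>2 - x\<^sub>1\<^sup>2\<close> lies in \<open>I\<close>.  So the maximum is \<open>1\<close> (lemma \<open>resolution_regularity\<close>).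
As the regularity is a definite description, a minimal resolution must also be exhibited: a
\<open>K\<close>-basis of the lowest degree component of a linear module gives a minimal cover, and this
is iterated (lemma \<open>linear_resolution_exists\<close>).\<close>


section \<open>Polynomials\<close>

abbreviation polys :: "nat \<Rightarrow> 'k::field mpoly set" where
  "polys n \<equiv> carrier (mpoly_ring n)"

definition var :: "nat \<Rightarrow> 'k::field mpoly" where
  "var i = Poly_Mapping.single (Poly_Mapping.single i 1) 1"

lemma in_polys_iff: "p \<in> polys n \<longleftrightarrow> (\<forall>m\<in>Poly_Mapping.keys p. Poly_Mapping.keys m \<subseteq> {..<n})"
  by (simp add: mpoly_ring_def)

lemma keys_uminus_poly [simp]: "Poly_Mapping.keys (- p) = Poly_Mapping.keys (p :: 'a \<Rightarrow>\<^sub>0 'k::ab_group_add)"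
  by (auto simp: in_keys_iff)

lemma polys_0 [simp, intro]: "0 \<in> polys n" and polys_1 [simp, intro]: "1 \<in> polys n"
  by (auto simp: in_polys_iff)

lemma polys_add [intro]: "p \<in> polys n \<Longrightarrow> q \<in> polys n \<Longrightarrow> p + q \<in> polys n"
  using subsetD[OF Poly_Mapping.keys_add[of p q]] by (auto simp: in_polys_iff)

lemma polys_uminus [intro]: "p \<in> polys n \<Longrightarrow> - p \<in> polys n"
  by (auto simp: in_polys_iff)

lemma polys_diff [intro]: "p \<in> polys n \<Longrightarrow> q \<in> polys n \<Longrightarrow> p - q \<in> polys n"
  using polys_add[of p n "- q"] by auto

lemma polys_mult [intro]: "p \<in> polys n \<Longrightarrow> q \<in> polys n \<Longrightarrow> p * q \<in> polys n"
  using cring.cring_simprules(5)[OF mpoly_ring_cring, of p n q] by (simp add: mpoly_ring_def)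

lemma polys_sum [intro]: "(\<And>x. x \<in> A \<Longrightarrow> f x \<in> polys n) \<Longrightarrow> sum f A \<in> polys n"
  by (induction A rule: infinite_finite_induct) auto

lemma polys_single: "Poly_Mapping.keys m \<subseteq> {..<n} \<Longrightarrow> Poly_Mapping.single m c \<in> polys n"
  by (auto simp: in_polys_iff split: if_splits)

lemma polys_const [simp, intro]: "Poly_Mapping.single 0 c \<in> polys n"
  by (rule polys_single) simp

lemma polys_var [intro]: "i < n \<Longrightarrow> var i \<in> polys n"
  unfolding var_def by (rule polys_single) auto

lemma single_times_eq_sum:
  fixes f :: "'a::cancel_comm_monoid_add \<Rightarrow>\<^sub>0 'k::comm_ring_1"
  shows "Poly_Mapping.single s c * f
    = (\<Sum>t\<in>Poly_Mapping.keys f. Poly_Mapping.single (s + t) (c * Poly_Mapping.lookup f t))"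
proof -
  have f: "f = (\<Sum>t\<in>Poly_Mapping.keys f. Poly_Mapping.single t (Poly_Mapping.lookup f t))"
    by (rule poly_mapping_eqI) (auto simp: lookup_sum lookup_single when_def in_keys_iff sum.delta')
  show ?thesis by (subst f) (simp add: sum_distrib_left mult_single)
qed

lemma lookup_single_times:
  fixes f :: "'a::cancel_comm_monoid_add \<Rightarrow>\<^sub>0 'k::comm_ring_1"
  shows "Poly_Mapping.lookup (Poly_Mapping.single s c * f) (s + t) = c * Poly_Mapping.lookup f t"
  unfolding single_times_eq_sum
  by (auto simp: lookup_sum lookup_single when_def in_keys_iff sum.delta' intro!: sum.neutral)

lemma keys_single_times:
  fixes f :: "'a::cancel_comm_monoid_add \<Rightarrow>\<^sub>0 'k::comm_ring_1"
  assumes "t \<in> Poly_Mapping.keys (Poly_Mapping.single s c * f)"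
  obtains t' where "t' \<in> Poly_Mapping.keys f" "t = s + t'"
  using subsetD[OF Poly_Mapping.keys_mult assms] by (auto split: if_splits)

text \<open>Multiplication by a monomial shifts the exponents without merging any two of them.\<close>

lemma single_times_cancel:
  fixes f :: "'a::cancel_comm_monoid_add \<Rightarrow>\<^sub>0 'k::comm_ring_1"
  assumes "Poly_Mapping.single s 1 * f = 0"
  shows "f = 0"
proof (rule poly_mapping_eqI)
  fix t
  from lookup_single_times[of s 1 f t] assms
  show "Poly_Mapping.lookup f t = Poly_Mapping.lookup 0 t" by simp
qed

lemma total_degree_superset:
  assumes "finite A" "Poly_Mapping.keys m \<subseteq> A"
  shows "total_degree m = (\<Sum>i\<in>A. Poly_Mapping.lookup m i)"
  unfolding total_degree_def by (rule sum.mono_neutral_left) (use assms in \<open>auto simp: in_keys_iff\<close>)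

lemma total_degree_add: "total_degree (m + m') = total_degree m + total_degree m'"
proof -
  let ?A = "Poly_Mapping.keys m \<union> Poly_Mapping.keys m'"
  show ?thesis
    by (subst (1 2 3) total_degree_superset[of ?A])
       (auto simp: lookup_add sum.distrib dest!: subsetD[OF Poly_Mapping.keys_add])
qed

lemma total_degree_single [simp]: "total_degree (Poly_Mapping.single i e) = e"
  by (simp add: total_degree_def)

lemma total_degree_0 [simp]: "total_degree 0 = 0"
  by (simp add: total_degree_def)

lemma total_degree_eq_0_iff: "total_degree m = 0 \<longleftrightarrow> m = 0"
  by (auto simp: total_degree_def in_keys_iff intro!: poly_mapping_eqI)

lemma in_mpoly_deg_iff:
  "p \<in> mpoly_deg n j \<longleftrightarrow> p \<in> polys n \<and> (\<forall>m\<in>Poly_Mapping.keys p. int (total_degree m) = j)"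
  by (simp add: mpoly_deg_def)

lemma var_mpoly_deg: "i < n \<Longrightarrow> var i \<in> mpoly_deg n 1"
  unfolding in_mpoly_deg_iff by (auto simp: polys_var) (simp add: var_def)

lemma const_mpoly_deg: "Poly_Mapping.single 0 c \<in> mpoly_deg n 0"
  by (auto simp: in_mpoly_deg_iff split: if_splits)

lemma mpoly_deg_0 [simp, intro]: "0 \<in> mpoly_deg n j"
  by (auto simp: in_mpoly_deg_iff)

lemma mpoly_deg_add [intro]: "p \<in> mpoly_deg n j \<Longrightarrow> q \<in> mpoly_deg n j \<Longrightarrow> p + q \<in> mpoly_deg n j"
  using subsetD[OF Poly_Mapping.keys_add[of p q]] by (auto simp: in_mpoly_deg_iff)

lemma mpoly_deg_uminus [intro]: "p \<in> mpoly_deg n j \<Longrightarrow> - p \<in> mpoly_deg n j"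
  by (auto simp: in_mpoly_deg_iff)

lemma mpoly_deg_mult [intro]:
  "p \<in> mpoly_deg n i \<Longrightarrow> q \<in> mpoly_deg n j \<Longrightarrow> p * q \<in> mpoly_deg n (i + j)"
  using subsetD[OF Poly_Mapping.keys_mult[of p q]] by (fastforce simp: in_mpoly_deg_iff total_degree_add)

text \<open>The homogeneous component of degree \<open>j\<close>.\<close>

definition hcomp :: "int \<Rightarrow> 'k::field mpoly \<Rightarrow> 'k mpoly" where
  "hcomp j p = Poly_Mapping.mapp (\<lambda>m c. c when int (total_degree m) = j) p"

lemma lookup_hcomp:
  "Poly_Mapping.lookup (hcomp j p) m = (if int (total_degree m) = j then Poly_Mapping.lookup p m else 0)"
  by (auto simp: hcomp_def lookup_mapp when_def in_keys_iff)

lemma keys_hcomp: "Poly_Mapping.keys (hcomp j p) = {m \<in> Poly_Mapping.keys p. int (total_degree m) = j}"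
  by (auto simp: in_keys_iff lookup_hcomp split: if_splits)

lemma hcomp_mpoly_deg: "p \<in> polys n \<Longrightarrow> hcomp j p \<in> mpoly_deg n j"
  by (auto simp: in_mpoly_deg_iff in_polys_iff keys_hcomp)

lemma hcomp_id: "(\<And>m. m \<in> Poly_Mapping.keys p \<Longrightarrow> int (total_degree m) = j) \<Longrightarrow> hcomp j p = p"
  by (rule poly_mapping_eqI) (auto simp: lookup_hcomp in_keys_iff)

lemma hcomp_eq_0: "(\<And>m. m \<in> Poly_Mapping.keys p \<Longrightarrow> int (total_degree m) \<noteq> j) \<Longrightarrow> hcomp j p = 0"
  by (rule poly_mapping_eqI) (auto simp: lookup_hcomp in_keys_iff)

lemma hcomp_of_deg: "p \<in> mpoly_deg n i \<Longrightarrow> hcomp j p = (if i = j then p else 0)"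
  by (auto simp: in_mpoly_deg_iff intro!: hcomp_id hcomp_eq_0)

lemma hcomp_0 [simp]: "hcomp j 0 = 0"
  by (rule hcomp_eq_0) auto

lemma hcomp_add: "hcomp j (p + q) = hcomp j p + hcomp j q"
  by (rule poly_mapping_eqI) (auto simp: lookup_hcomp lookup_add)

lemma hcomp_diff: "hcomp j (p - q) = hcomp j p - hcomp j q"
  by (rule poly_mapping_eqI) (auto simp: lookup_hcomp lookup_minus)

lemma hcomp_sum: "hcomp j (sum f A) = (\<Sum>x\<in>A. hcomp j (f x))"
  by (induction A rule: infinite_finite_induct) (auto simp: hcomp_add)

lemma hcomp_mult:
  assumes "q \<in> mpoly_deg n i"
  shows "hcomp j (q * p) = q * hcomp (j - i) p"
proof -
  \<comment> \<open>The component of \<open>p\<close> of degree \<open>j - i\<close> is the only one that \<open>q\<close> moves to degree \<open>j\<close>.\<close>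
  have "hcomp j (q * hcomp (j - i) p) = q * hcomp (j - i) p"
    using subsetD[OF Poly_Mapping.keys_mult[of q "hcomp (j - i) p"]] assms
    by (intro hcomp_id) (fastforce simp: in_mpoly_deg_iff total_degree_add keys_hcomp)
  moreover have "hcomp j (q * (p - hcomp (j - i) p)) = 0"
  proof (rule hcomp_eq_0)
    fix m assume "m \<in> Poly_Mapping.keys (q * (p - hcomp (j - i) p))"
    then obtain s t where st: "s \<in> Poly_Mapping.keys q" "t \<in> Poly_Mapping.keys (p - hcomp (j - i) p)" "m = s + t"
      using subsetD[OF Poly_Mapping.keys_mult] by blast
    from st(2) have "int (total_degree t) \<noteq> j - i"
      by (auto simp: in_keys_iff lookup_minus lookup_hcomp split: if_splits)
    with st assms show "int (total_degree m) \<noteq> j"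
      by (auto simp: in_mpoly_deg_iff total_degree_add)
  qed
  ultimately show ?thesis
    by (metis add.right_neutral diff_add_cancel distrib_left hcomp_add add.commute)
qed

lemma sum_hcomp:
  assumes "finite J" "\<And>m. m \<in> Poly_Mapping.keys p \<Longrightarrow> int (total_degree m) \<in> J"
  shows "(\<Sum>j\<in>J. hcomp j p) = p"
proof (rule poly_mapping_eqI)
  fix m
  show "Poly_Mapping.lookup (\<Sum>j\<in>J. hcomp j p) m = Poly_Mapping.lookup p m"
    using assms(2)[of m] assms(1) by (auto simp: lookup_sum lookup_hcomp in_keys_iff)
qed

lemma monomial_add_eq_0_iff: "s + t = 0 \<longleftrightarrow> s = 0 \<and> t = (0 :: nat \<Rightarrow>\<^sub>0 nat)"
  by (auto simp: poly_mapping_eq_iff fun_eq_iff lookup_add)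

text \<open>The exponent \<open>0\<close> is a sum of two exponents only as \<open>0 + 0\<close>.\<close>

lemma const_coeff_mult:
  fixes p q :: "'k::field mpoly"
  shows "Poly_Mapping.lookup (p * q) 0 = Poly_Mapping.lookup p 0 * Poly_Mapping.lookup q 0"
proof -
  define c :: "'k mpoly" where "c = Poly_Mapping.single 0 (Poly_Mapping.lookup p 0)"
  have "0 \<notin> Poly_Mapping.keys ((p - c) * q)"
  proof
    assume "0 \<in> Poly_Mapping.keys ((p - c) * q)"
    then obtain s t where "s \<in> Poly_Mapping.keys (p - c)" "0 = s + t"
      using subsetD[OF Poly_Mapping.keys_mult] by blast
    then show False
      by (metis c_def diff_self in_keys_iff lookup_minus lookup_single_eq monomial_add_eq_0_iff)
  qed
  then have "Poly_Mapping.lookup (p * q) 0 = Poly_Mapping.lookup (c * q) 0"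
    by (simp add: in_keys_iff left_diff_distrib lookup_minus)
  also have "\<dots> = Poly_Mapping.lookup p 0 * Poly_Mapping.lookup q 0"
    using lookup_single_times[of 0 "Poly_Mapping.lookup p 0" q 0] by (simp add: c_def)
  finally show ?thesis .
qed

lemma monomial_split:
  fixes m :: "nat \<Rightarrow>\<^sub>0 nat"
  assumes "i \<in> Poly_Mapping.keys m"
  obtains m' where "m = Poly_Mapping.single i 1 + m'" "Poly_Mapping.keys m' \<subseteq> Poly_Mapping.keys m"
proof
  show "m = Poly_Mapping.single i 1 + (m - Poly_Mapping.single i 1)"
    using assms by (intro poly_mapping_eqI) (auto simp: lookup_add lookup_minus lookup_single when_def in_keys_iff)
  show "Poly_Mapping.keys (m - Poly_Mapping.single i 1) \<subseteq> Poly_Mapping.keys m"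
    by (auto simp: in_keys_iff lookup_minus)
qed

lemma monomial_as_multiple:
  fixes m :: "nat \<Rightarrow>\<^sub>0 nat"
  assumes "i \<in> Poly_Mapping.keys m" "Poly_Mapping.keys m \<subseteq> {..<n}"
  obtains q where "q \<in> polys n" "Poly_Mapping.single m c = var i * q"
proof -
  obtain m' where "m = Poly_Mapping.single i 1 + m'" "Poly_Mapping.keys m' \<subseteq> Poly_Mapping.keys m"
    using monomial_split[OF assms(1)] .
  then have "Poly_Mapping.single m c = var i * Poly_Mapping.single m' c" "Poly_Mapping.single m' c \<in> polys n"
    using assms(2) by (auto simp: var_def mult_single intro!: polys_single)
  then show ?thesis using that by blast
qed

text \<open>The polynomials without constant term form an ideal that contains the variables; conversely each
of their monomials is a multiple of some variable.\<close>

lemma in_irrelevant_ideal_iff: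
  fixes p :: "'k::field mpoly"
  shows "p \<in> irrelevant_ideal n \<longleftrightarrow> p \<in> polys n \<and> Poly_Mapping.lookup p 0 = 0"
proof
  interpret cring "mpoly_ring n :: 'k mpoly ring" by (rule mpoly_ring_cring)
  let ?G = "{Poly_Mapping.single (Poly_Mapping.single i 1) 1 | i. i < n} :: 'k mpoly set"
  have G: "?G \<subseteq> polys n"
    using polys_var[where ?'a = 'k] by (auto simp: var_def)
  have one0: "Poly_Mapping.lookup (Poly_Mapping.single (Poly_Mapping.single i (Suc 0)) 1 :: 'k mpoly) 0 = 0" for i
    by (simp add: lookup_single when_def poly_mapping_eq_iff fun_eq_iff)
  have "ideal {p \<in> polys n. Poly_Mapping.lookup p 0 = 0} (mpoly_ring n :: 'k mpoly ring)"
  proof (rule idealI)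
    show "subgroup {p \<in> polys n. Poly_Mapping.lookup p 0 = 0} (add_monoid (mpoly_ring n :: 'k mpoly ring))"
    proof (rule add.subgroupI)
      fix a :: "'k mpoly" assume a: "a \<in> {p \<in> polys n. Poly_Mapping.lookup p 0 = 0}"
      have "\<ominus>\<^bsub>mpoly_ring n\<^esub> a = - a"
        by (rule minus_equality) (use a in \<open>auto simp: mpoly_ring_def\<close>)
      then show "\<ominus>\<^bsub>mpoly_ring n\<^esub> a \<in> {p \<in> polys n. Poly_Mapping.lookup p 0 = 0}"
        using a by auto
    next
      show "{p \<in> polys n. Poly_Mapping.lookup p 0 = 0} \<noteq> ({} :: 'k mpoly set)"
        by (auto intro!: exI[of _ 0])
    next
      fix a b :: "'k mpoly" assume "a \<in> {p \<in> polys n. Poly_Mapping.lookup p 0 = 0}" "b \<in> {p \<in> polys n. Poly_Mapping.lookup p 0 = 0}"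
      then show "a \<oplus>\<^bsub>mpoly_ring n\<^esub> b \<in> {p \<in> polys n. Poly_Mapping.lookup p 0 = 0}"
        using polys_add[of a n b] by (auto simp: mpoly_ring_def lookup_add)
    qed auto
  next
    fix a x :: "'k mpoly" assume *: "a \<in> {p \<in> polys n. Poly_Mapping.lookup p 0 = 0}" "x \<in> polys n"
    then show "x \<otimes>\<^bsub>mpoly_ring n\<^esub> a \<in> {p \<in> polys n. Poly_Mapping.lookup p 0 = 0}"
       "a \<otimes>\<^bsub>mpoly_ring n\<^esub> x \<in> {p \<in> polys n. Poly_Mapping.lookup p 0 = 0}"
      using polys_mult[of a n x] polys_mult[of x n a] by (auto simp: mpoly_ring_def const_coeff_mult)
  qed (rule ring_axioms)
  then have "irrelevant_ideal n \<subseteq> {p \<in> polys n. Poly_Mapping.lookup p 0 = (0::'k)}"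
    unfolding irrelevant_ideal_def
    by (rule genideal_minimal) (use G in \<open>auto simp: one0\<close>)
  then show "p \<in> irrelevant_ideal n \<Longrightarrow> p \<in> polys n \<and> Poly_Mapping.lookup p 0 = 0" by auto
  assume p: "p \<in> polys n \<and> Poly_Mapping.lookup p 0 = 0"
  interpret I: ideal "irrelevant_ideal n" "mpoly_ring n :: 'k mpoly ring"
    unfolding irrelevant_ideal_def by (rule genideal_ideal[OF G])
  have gen: "var i \<in> (irrelevant_ideal n :: 'k mpoly set)" if "i < n" for i
    unfolding irrelevant_ideal_def by (rule subsetD[OF genideal_self[OF G]]) (use that in \<open>auto simp: var_def\<close>)
  have "Poly_Mapping.single m (Poly_Mapping.lookup p m) \<in> irrelevant_ideal n" if m: "m \<in> Poly_Mapping.keys p" for m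
  proof -
    from m p have "m \<noteq> 0" "Poly_Mapping.keys m \<subseteq> {..<n}" by (auto simp: in_polys_iff in_keys_iff)
    then obtain i where i: "i \<in> Poly_Mapping.keys m" using keys_eq_empty by blast
    then obtain q where q: "q \<in> polys n" "Poly_Mapping.single m (Poly_Mapping.lookup p m) = var i * q"
      using monomial_as_multiple[of i m n] \<open>Poly_Mapping.keys m \<subseteq> {..<n}\<close> by metis
    with i have "var i \<otimes>\<^bsub>mpoly_ring n\<^esub> q \<in> irrelevant_ideal n"
      using \<open>Poly_Mapping.keys m \<subseteq> {..<n}\<close> by (intro I.I_r_closed gen) auto
    with q(2) show ?thesis by (simp add: mpoly_ring_def)
  qed
  moreover have "sum f A \<in> irrelevant_ideal n" if "\<And>m. m \<in> A \<Longrightarrow> f m \<in> irrelevant_ideal n" for f :: "(nat \<Rightarrow>\<^sub>0 nat) \<Rightarrow> 'k mpoly" and A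
    using that
  proof (induction A rule: infinite_finite_induct)
    case (insert x A)
    then show ?case using I.a_closed[of "f x" "sum f A"] by (simp add: mpoly_ring_def)
  qed (use I.zero_closed in \<open>auto simp: mpoly_ring_def\<close>)
  ultimately show "p \<in> irrelevant_ideal n"
    by (subst poly_mapping_eq_sum_single) auto
qed


section \<open>Graded free modules\<close>

lemmas fun_apply = plus_fun_apply zero_fun_apply minus_apply uminus_apply
\<comment> \<open>Vectors are functions, and the simplifier would replace equations between vectors by pointwise
  ones to which the laws of modules no longer apply.\<close>
declare fun_apply [simp del]

abbreviation free :: "nat \<Rightarrow> int list \<Rightarrow> (nat \<Rightarrow> 'k::field mpoly) set" where
  "free n es \<equiv> carrier (free_mod n es)"

definition scal :: "'k::field mpoly \<Rightarrow> (nat \<Rightarrow> 'k mpoly) \<Rightarrow> (nat \<Rightarrow> 'k mpoly)" where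
  "scal p u = (\<lambda>j. p * u j)"

text \<open>The vector with entry \<open>p\<close> at position \<open>j\<close>, that is, \<open>p\<close> times the \<open>j\<close>-th basis vector.\<close>

definition unit_vec :: "nat \<Rightarrow> 'k::field mpoly \<Rightarrow> (nat \<Rightarrow> 'k mpoly)" where
  "unit_vec j p = (\<lambda>i. if i = j then p else 0)"

definition vcomp :: "int list \<Rightarrow> int \<Rightarrow> (nat \<Rightarrow> 'k::field mpoly) \<Rightarrow> (nat \<Rightarrow> 'k mpoly)" where
  "vcomp es j v = (\<lambda>i. if i < length es then hcomp (j - es ! i) (v i) else 0)"

lemma free_mod_simps [simp]:
  "zero (free_mod n es) = 0" "add (free_mod n es) = (+)" "smult (free_mod n es) = scal"
  by (auto simp: fun_apply free_mod_def fun_eq_iff scal_def)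

lemma in_free_iff: "v \<in> free n es \<longleftrightarrow> (\<forall>j<length es. v j \<in> polys n) \<and> (\<forall>j\<ge>length es. v j = 0)"
  by (simp add: free_mod_def)

lemma free_coord: "v \<in> free n es \<Longrightarrow> v j \<in> polys n"
  by (cases "j < length es") (auto simp: fun_apply in_free_iff)

lemma in_free_deg_iff:
  "v \<in> free_mod_deg n es i \<longleftrightarrow> v \<in> free n es \<and> (\<forall>j<length es. v j \<in> mpoly_deg n (i - es ! j))"
  by (simp add: free_mod_deg_def)

lemma scal_simps:
  "scal p (u + v) = scal p u + scal p v" "scal p (u - v) = scal p u - scal p v" "scal p (- v) = - scal p v"
  "scal (p + q) u = scal p u + scal q u" "scal p (scal q u) = scal (p * q) u"
  "scal p 0 = 0" "scal 0 u = 0" "scal 1 u = u"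
  by (auto simp: fun_apply scal_def fun_eq_iff algebra_simps)

lemma sum_fun_apply: "sum f A x = (\<Sum>a\<in>A. f a x)" for f :: "'a \<Rightarrow> 'b \<Rightarrow> 'c::comm_monoid_add"
  by (induction A rule: infinite_finite_induct) (auto simp: fun_apply)

lemma unit_vec_free: "j < length es \<Longrightarrow> p \<in> polys n \<Longrightarrow> unit_vec j p \<in> free n es"
  by (auto simp: fun_apply in_free_iff unit_vec_def)

lemma free_eq_sum_unit_vec:
  assumes "v \<in> free n es"
  shows "v = (\<Sum>j<length es. unit_vec j (v j))"
  using assms by (auto simp: fun_apply fun_eq_iff sum_fun_apply unit_vec_def in_free_iff sum.delta')

lemma free_deg_add: "u \<in> free_mod_deg n es j \<Longrightarrow> v \<in> free_mod_deg n es j \<Longrightarrow> u + v \<in> free_mod_deg n es j"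
  by (auto simp: fun_apply in_free_deg_iff in_free_iff polys_add)

lemma free_deg_uminus: "u \<in> free_mod_deg n es j \<Longrightarrow> - u \<in> free_mod_deg n es j"
  by (auto simp: fun_apply in_free_deg_iff in_free_iff)

lemma free_deg_diff: "u \<in> free_mod_deg n es j \<Longrightarrow> v \<in> free_mod_deg n es j \<Longrightarrow> u - v \<in> free_mod_deg n es j"
  using free_deg_add[of u n es j "- v"] free_deg_uminus[of v n es j] by simp

lemma free_deg_scal:
  assumes "p \<in> mpoly_deg n i" "u \<in> free_mod_deg n es j"
  shows "scal p u \<in> free_mod_deg n es (i + j)"
proof -
  have "p * u l \<in> mpoly_deg n (i + j - es ! l)" if "l < length es" for l
    using mpoly_deg_mult[OF assms(1), of "u l" "j - es ! l"] assms(2) that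
    by (simp add: in_free_deg_iff algebra_simps)
  then show ?thesis
    using assms by (auto simp: fun_apply in_free_deg_iff in_free_iff scal_def in_mpoly_deg_iff)
qed

lemma vcomp_free_deg: "v \<in> free n es \<Longrightarrow> vcomp es j v \<in> free_mod_deg n es j"
  using hcomp_mpoly_deg[of _ n] by (auto simp: fun_apply in_free_deg_iff in_free_iff vcomp_def in_mpoly_deg_iff)

lemma vcomp_of_deg: "v \<in> free_mod_deg n es i \<Longrightarrow> vcomp es j v = (if i = j then v else 0)"
  by (auto simp: fun_apply fun_eq_iff in_free_deg_iff in_free_iff vcomp_def hcomp_of_deg)

lemma vcomp_add: "vcomp es j (u + v) = vcomp es j u + vcomp es j v"
  by (auto simp: fun_apply fun_eq_iff vcomp_def hcomp_add)

lemma vcomp_0 [simp]: "vcomp es j 0 = 0"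
  by (auto simp: fun_apply fun_eq_iff vcomp_def)

lemma vcomp_sum: "vcomp es j (sum f A) = (\<Sum>x\<in>A. vcomp es j (f x))"
  by (induction A rule: infinite_finite_induct) (auto simp: vcomp_add)

lemma vcomp_scal: "q \<in> mpoly_deg n i \<Longrightarrow> vcomp es j (scal q v) = scal q (vcomp es (j - i) v)"
  by (auto simp: fun_apply fun_eq_iff vcomp_def scal_def hcomp_mult algebra_simps)

text \<open>The degree \<open>i\<close> is put into the index set on request, so that its component can be split off from
the sum without asking whether it vanishes.\<close>

lemma obtain_vcomp_decomposition:
  assumes "v \<in> free n es"
  obtains J where "finite J" "i \<in> J" "v = (\<Sum>j\<in>J. vcomp es j v)"
proof
  define J where "J = insert i (\<Union>l<length es. (\<lambda>m. int (total_degree m) + es ! l) ` Poly_Mapping.keys (v l))"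
  show "finite J" "i \<in> J" by (auto simp: J_def)
  have "v l = (\<Sum>j\<in>J. vcomp es j v l)" for l
  proof (cases "l < length es")
    case True
    let ?J = "(\<lambda>j. j - es ! l) ` J"
    have "v l = (\<Sum>j\<in>?J. hcomp j (v l))"
      using True by (intro sum_hcomp[symmetric]) (force simp: J_def)+
    also have "\<dots> = (\<Sum>j\<in>J. hcomp (j - es ! l) (v l))"
      by (subst sum.reindex) (auto simp: inj_on_def)
    finally show ?thesis using True by (simp add: vcomp_def)
  qed (use assms in \<open>auto simp: vcomp_def in_free_iff\<close>)
  then show "v = (\<Sum>j\<in>J. vcomp es j v)" by (auto simp: fun_apply fun_eq_iff sum_fun_apply)
qed

text \<open>Closure under homogeneous components is what makes the submodule graded.\<close>

definition graded_submodule :: "nat \<Rightarrow> int list \<Rightarrow> (nat \<Rightarrow> 'k::field mpoly) set \<Rightarrow> bool" where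
  "graded_submodule n es N \<longleftrightarrow> N \<subseteq> free n es \<and> 0 \<in> N \<and> (\<forall>u\<in>N. \<forall>v\<in>N. u + v \<in> N) \<and>
     (\<forall>p\<in>polys n. \<forall>u\<in>N. scal p u \<in> N) \<and> (\<forall>j. \<forall>u\<in>N. vcomp es j u \<in> N)"

lemma graded_submoduleD:
  assumes "graded_submodule n es N"
  shows "u \<in> N \<Longrightarrow> u \<in> free n es" "0 \<in> N" "u \<in> N \<Longrightarrow> v \<in> N \<Longrightarrow> u + v \<in> N"
    "p \<in> polys n \<Longrightarrow> u \<in> N \<Longrightarrow> scal p u \<in> N" "u \<in> N \<Longrightarrow> vcomp es j u \<in> N"
    "u \<in> N \<Longrightarrow> - u \<in> N" "u \<in> N \<Longrightarrow> v \<in> N \<Longrightarrow> u - v \<in> N"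
    "(\<And>x. x \<in> A \<Longrightarrow> f x \<in> N) \<Longrightarrow> sum f A \<in> N"
proof -
  show *: "u \<in> N \<Longrightarrow> u \<in> free n es" "0 \<in> N" "\<And>u v. u \<in> N \<Longrightarrow> v \<in> N \<Longrightarrow> u + v \<in> N"
    "\<And>u p. p \<in> polys n \<Longrightarrow> u \<in> N \<Longrightarrow> scal p u \<in> N" "u \<in> N \<Longrightarrow> vcomp es j u \<in> N" for u
    using assms by (auto simp: graded_submodule_def)
  show u: "- u \<in> N" if "u \<in> N" for u
  proof -
    have "- u = scal (- 1) u" by (auto simp: fun_apply fun_eq_iff scal_def)
    with *(4)[of "- 1" u] that show ?thesis by (metis polys_1 polys_uminus)
  qed
  show "u \<in> N \<Longrightarrow> v \<in> N \<Longrightarrow> u - v \<in> N" using *(3)[of u "- v"] u[of v] by simp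
  show "(\<And>x. x \<in> A \<Longrightarrow> f x \<in> N) \<Longrightarrow> sum f A \<in> N"
    by (induction A rule: infinite_finite_induct) (use * in auto)
qed

lemma graded_submodule_free: "graded_submodule n es (free n es)"
  unfolding graded_submodule_def
  using vcomp_free_deg[of _ n es]
  by (auto simp: in_free_deg_iff) (auto simp: fun_apply in_free_iff scal_def)

lemma graded_hom_free_iff:
  "\<phi> \<in> graded_hom n (free_mod n es') (free_mod_deg n es') (free_mod n es) (free_mod_deg n es) \<longleftrightarrow>
     (\<forall>u\<in>free n es'. \<phi> u \<in> free n es) \<and>
     (\<forall>u\<in>free n es'. \<forall>v\<in>free n es'. \<phi> (u + v) = \<phi> u + \<phi> v) \<and>
     (\<forall>p\<in>polys n. \<forall>u\<in>free n es'. \<phi> (scal p u) = scal p (\<phi> u)) \<and>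
     (\<forall>j. \<forall>u\<in>free_mod_deg n es' j. \<phi> u \<in> free_mod_deg n es j)"
  unfolding graded_hom_def by (simp add: Pi_iff image_subset_iff)

lemma graded_hom_freeD:
  assumes "\<phi> \<in> graded_hom n (free_mod n es') (free_mod_deg n es') (free_mod n es) (free_mod_deg n es)"
  shows "u \<in> free n es' \<Longrightarrow> \<phi> u \<in> free n es"
    "u \<in> free n es' \<Longrightarrow> v \<in> free n es' \<Longrightarrow> \<phi> (u + v) = \<phi> u + \<phi> v"
    "p \<in> polys n \<Longrightarrow> u \<in> free n es' \<Longrightarrow> \<phi> (scal p u) = scal p (\<phi> u)"
    "u \<in> free_mod_deg n es' j \<Longrightarrow> \<phi> u \<in> free_mod_deg n es j"
    "\<phi> 0 = 0"
    "u \<in> free n es' \<Longrightarrow> v \<in> free n es' \<Longrightarrow> \<phi> (u - v) = \<phi> u - \<phi> v"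
    "(\<And>x. x \<in> A \<Longrightarrow> f x \<in> free n es') \<Longrightarrow> \<phi> (sum f A) = (\<Sum>x\<in>A. \<phi> (f x))"
    "u \<in> free n es' \<Longrightarrow> \<phi> (vcomp es' j u) = vcomp es j (\<phi> u)"
proof -
  note F = graded_submoduleD[OF graded_submodule_free]
  show *: "\<And>u. u \<in> free n es' \<Longrightarrow> \<phi> u \<in> free n es"
    "\<And>u v. u \<in> free n es' \<Longrightarrow> v \<in> free n es' \<Longrightarrow> \<phi> (u + v) = \<phi> u + \<phi> v"
    "\<And>u p. p \<in> polys n \<Longrightarrow> u \<in> free n es' \<Longrightarrow> \<phi> (scal p u) = scal p (\<phi> u)"
    "\<And>u j. u \<in> free_mod_deg n es' j \<Longrightarrow> \<phi> u \<in> free_mod_deg n es j"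
    using assms by (auto simp: graded_hom_free_iff)
  show z: "\<phi> 0 = 0"
    by (metis *(2) F(2) add_cancel_right_right add_0_left)
  show "u \<in> free n es' \<Longrightarrow> v \<in> free n es' \<Longrightarrow> \<phi> (u - v) = \<phi> u - \<phi> v"
    using *(2)[of "u - v" v] F(7)[of u n es' v] by (simp add: algebra_simps)
  show s: "(\<And>x. x \<in> A \<Longrightarrow> f x \<in> free n es') \<Longrightarrow> \<phi> (sum f A) = (\<Sum>x\<in>A. \<phi> (f x))" for A and f :: "'c \<Rightarrow> _"
  proof (induction A rule: infinite_finite_induct)
    case (insert x A)
    then have "f x \<in> free n es'" "sum f A \<in> free n es'" using F(8)[of A f] by auto
    with insert show ?case using *(2)[of "f x" "sum f A"] by simp
  qed (simp_all add: z)
  show "\<phi> (vcomp es' j u) = vcomp es j (\<phi> u)" if u: "u \<in> free n es'"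
  proof -
    obtain J where J: "finite J" "j \<in> J" "u = (\<Sum>i\<in>J. vcomp es' i u)"
      using obtain_vcomp_decomposition[OF u] .
    have "vcomp es j (\<phi> u) = vcomp es j (\<Sum>i\<in>J. \<phi> (vcomp es' i u))"
      by (subst J(3), subst s) (use F(5) u in auto)
    also have "\<dots> = (\<Sum>i\<in>J. if i = j then \<phi> (vcomp es' i u) else 0)"
      unfolding vcomp_sum by (intro sum.cong refl vcomp_of_deg[of _ n] *(4) vcomp_free_deg u)
    finally show ?thesis using J by simp
  qed
qed

lemma graded_submodule_kernel:
  assumes \<phi>: "\<phi> \<in> graded_hom n (free_mod n es') (free_mod_deg n es') (free_mod n es) (free_mod_deg n es)"
  shows "graded_submodule n es' {u \<in> free n es'. \<phi> u = 0}"
  unfolding graded_submodule_def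
  using graded_submoduleD(1-5)[OF graded_submodule_free[of n es']] graded_hom_freeD[OF \<phi>]
  by (auto simp: scal_simps)


section \<open>A regularity criterion that passes to syzygies\<close>

text \<open>The variables are adjoined one after the other in the order \<open>\<sigma>\<close>.  The criterion below depends on
this order.\<close>

locale var_order =
  fixes n :: nat and \<sigma> :: "nat \<Rightarrow> nat"
  assumes inj_\<sigma>: "inj_on \<sigma> {..<n}" and range_\<sigma>: "\<sigma> ` {..<n} = {..<n}"
begin

lemma \<sigma>_less: "s < n \<Longrightarrow> \<sigma> s < n"
  using range_\<sigma> by auto

text \<open>The submodule \<open>(y\<^sub>1, \<dots>, y\<^sub>s)N\<close>, where \<open>y\<^sub>i\<close> is the \<open>i\<close>-th variable in the order \<open>\<sigma>\<close>.\<close>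

primrec var_span :: "nat \<Rightarrow> (nat \<Rightarrow> 'k::field mpoly) set \<Rightarrow> (nat \<Rightarrow> 'k mpoly) set" where
  "var_span 0 N = {0}"
| "var_span (Suc s) N = {w + scal (var (\<sigma> s)) f | w f. w \<in> var_span s N \<and> f \<in> N}"

lemma graded_submodule_var_span:
  assumes N: "graded_submodule n es N"
  shows "s \<le> n \<Longrightarrow> graded_submodule n es (var_span s N)"
proof (induction s)
  case 0
  show ?case using graded_submoduleD(1,2)[OF N] by (auto simp: graded_submodule_def scal_simps)
next
  case (Suc s)
  note ND = graded_submoduleD[OF N]
  note W = graded_submoduleD[OF Suc.IH[OF Suc_leD[OF Suc.prems]]]
  have v: "var (\<sigma> s) \<in> polys n" using \<sigma>_less[of s] Suc.prems by auto
  show ?case unfolding graded_submodule_def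
  proof (intro conjI ballI allI)
    show "var_span (Suc s) N \<subseteq> free n es"
      using W(1) ND(1)[OF ND(4)[OF v]] graded_submoduleD(3)[OF graded_submodule_free] by fastforce
    show "0 \<in> var_span (Suc s) N"
      using W(2) ND(2) by (auto simp: scal_simps intro!: exI[of _ 0])
  next
    fix x y :: "nat \<Rightarrow> 'a mpoly" assume "x \<in> var_span (Suc s) N" "y \<in> var_span (Suc s) N"
    then obtain w f w' f' where *: "w \<in> var_span s N" "w' \<in> var_span s N" "f \<in> N" "f' \<in> N"
      "x = w + scal (var (\<sigma> s)) f" "y = w' + scal (var (\<sigma> s)) f'" by auto
    then have "x + y = (w + w') + scal (var (\<sigma> s)) (f + f')" by (simp add: scal_simps)
    with W(3)[OF *(1,2)] ND(3)[OF *(3,4)] show "x + y \<in> var_span (Suc s) N"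
      unfolding var_span.simps by blast
  next
    fix p :: "'a mpoly" and x assume p: "p \<in> polys n" and "x \<in> var_span (Suc s) N"
    then obtain w f where *: "w \<in> var_span s N" "f \<in> N" "x = w + scal (var (\<sigma> s)) f" by auto
    then have "scal p x = scal p w + scal (var (\<sigma> s)) (scal p f)" by (simp add: scal_simps mult.commute)
    with W(4)[OF p *(1)] ND(4)[OF p *(2)] show "scal p x \<in> var_span (Suc s) N"
      unfolding var_span.simps by blast
  next
    fix j and x :: "nat \<Rightarrow> 'a mpoly" assume "x \<in> var_span (Suc s) N"
    then obtain w f where *: "w \<in> var_span s N" "f \<in> N" "x = w + scal (var (\<sigma> s)) f" by auto
    then have "vcomp es j x = vcomp es j w + scal (var (\<sigma> s)) (vcomp es (j - 1) f)"
      by (simp only: *(3) vcomp_add vcomp_scal[OF var_mpoly_deg[OF \<sigma>_less[OF Suc_le_lessD[OF Suc.prems]]]])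
    with W(5)[OF *(1)] ND(5)[OF *(2)] show "vcomp es j x \<in> var_span (Suc s) N"
      unfolding var_span.simps by blast
  qed
qed

lemma var_span_mono: "N \<subseteq> N' \<Longrightarrow> var_span s N \<subseteq> var_span s N'"
  by (induction s) (simp, auto 0 4)

text \<open>A homogeneous element has a representation with homogeneous coefficients: take components.\<close>

lemma var_span_Suc_homogeneous:
  assumes N: "graded_submodule n es N" and "s < n"
    and u: "u \<in> var_span (Suc s) N" "u \<in> free_mod_deg n es j"
  obtains w f where "w \<in> var_span s N" "w \<in> free_mod_deg n es j" "f \<in> N" "f \<in> free_mod_deg n es (j - 1)"
    "u = w + scal (var (\<sigma> s)) f"
proof -
  note ND = graded_submoduleD[OF N]
  have W: "graded_submodule n es (var_span s N)"
    using graded_submodule_var_span[OF N] \<open>s < n\<close> by auto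
  note WD = graded_submoduleD[OF this]
  obtain w f where *: "w \<in> var_span s N" "f \<in> N" "u = w + scal (var (\<sigma> s)) f" using u by auto
  have "u = vcomp es j u" using vcomp_of_deg[OF u(2)] by simp
  also have "\<dots> = vcomp es j w + scal (var (\<sigma> s)) (vcomp es (j - 1) f)"
    by (simp only: *(3) vcomp_add vcomp_scal[OF var_mpoly_deg[OF \<sigma>_less[OF \<open>s < n\<close>]]])
  finally show ?thesis
    using that[of "vcomp es j w" "vcomp es (j - 1) f"] * WD(1,5) ND(1,5) vcomp_free_deg by blast
qed

lemma var_span_image:
  assumes \<phi>: "\<phi> \<in> graded_hom n (free_mod n es') (free_mod_deg n es') (free_mod n es) (free_mod_deg n es)"
    and "s \<le> n"
  shows "\<phi> ` var_span s (free n es') = var_span s (\<phi> ` free n es')"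
  using \<open>s \<le> n\<close>
proof (induction s)
  case 0
  show ?case using graded_hom_freeD(5)[OF \<phi>] by simp
next
  case (Suc s)
  have W: "u \<in> free n es'" if "u \<in> var_span s (free n es')" for u
    using graded_submoduleD(1)[OF graded_submodule_var_span[OF graded_submodule_free[of n es'], of s]] that Suc.prems
    by simp
  have v: "var (\<sigma> s) \<in> polys n" using \<sigma>_less[of s] Suc.prems by auto
  note D = graded_hom_freeD[OF \<phi>]
  have e: "\<phi> (w + scal (var (\<sigma> s)) f) = \<phi> w + scal (var (\<sigma> s)) (\<phi> f)"
    if "w \<in> var_span s (free n es')" "f \<in> free n es'" for w f
    using D(2)[OF W[OF that(1)], of "scal (var (\<sigma> s)) f"] D(3)[OF v that(2)]
      graded_submoduleD(4)[OF graded_submodule_free v that(2)] by simp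
  have IH: "\<phi> ` var_span s (free n es') = var_span s (\<phi> ` free n es')" using Suc by simp
  show ?case
  proof (intro antisym subsetI)
    fix x assume "x \<in> \<phi> ` var_span (Suc s) (free n es')"
    then obtain w f where *: "w \<in> var_span s (free n es')" "f \<in> free n es'"
      "x = \<phi> (w + scal (var (\<sigma> s)) f)" by auto
    moreover have "\<phi> w \<in> var_span s (\<phi> ` free n es')" using IH *(1) by blast
    ultimately show "x \<in> var_span (Suc s) (\<phi> ` free n es')"
      unfolding var_span.simps using e by blast
  next
    fix x assume "x \<in> var_span (Suc s) (\<phi> ` free n es')"
    then obtain w f where *: "w \<in> var_span s (\<phi> ` free n es')" "f \<in> free n es'"
      "x = w + scal (var (\<sigma> s)) (\<phi> f)" by auto
    then obtain w' where "w' \<in> var_span s (free n es')" "w = \<phi> w'"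
      unfolding IH[symmetric] by blast
    with * e show "x \<in> \<phi> ` var_span (Suc s) (free n es')"
      by (auto intro!: image_eqI[of _ _ "w' + scal (var (\<sigma> s)) f"])
  qed
qed

lemma var_span_generator:
  assumes N: "graded_submodule n es N" and "l < s" "s \<le> n" "f \<in> N"
  shows "scal (var (\<sigma> l)) f \<in> var_span s N"
  using \<open>l < s\<close> \<open>s \<le> n\<close>
proof (induction s)
  case (Suc s)
  have W: "graded_submodule n es (var_span s N)"
    using graded_submodule_var_span[OF N] Suc.prems by auto
  show ?case
  proof (cases "l = s")
    case True
    then have "scal (var (\<sigma> l)) f = 0 + scal (var (\<sigma> s)) f" by simp
    then show ?thesis using graded_submoduleD(2)[OF W] \<open>f \<in> N\<close> unfolding var_span.simps by blast
  next
    case False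
    then have "scal (var (\<sigma> l)) f \<in> var_span s N" using Suc by auto
    moreover have "scal (var (\<sigma> l)) f = scal (var (\<sigma> l)) f + scal (var (\<sigma> s)) 0" by (simp add: scal_simps)
    ultimately show ?thesis using graded_submoduleD(2)[OF N] unfolding var_span.simps by blast
  qed
qed simp

lemma var_span_subset:
  assumes N: "graded_submodule n es N" and "s \<le> n"
  shows "var_span s N \<subseteq> N"
  using \<open>s \<le> n\<close>
proof (induction s)
  case 0
  then show ?case using graded_submoduleD(2)[OF N] by simp
next
  case (Suc s)
  then have "var (\<sigma> s) \<in> polys n" using \<sigma>_less by auto
  then have "w + scal (var (\<sigma> s)) f \<in> N" if "w \<in> var_span s N" "f \<in> N" for w f
    using graded_submoduleD(3,4)[OF N] Suc that by (meson Suc_leD subsetD)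
  then show ?case by auto
qed

text \<open>In a free module, membership in \<open>(y\<^sub>1, \<dots>, y\<^sub>s)F\<close> can be read off the monomials.\<close>

lemma in_var_span_free_iff:
  assumes "s \<le> n"
  shows "u \<in> var_span s (free n es) \<longleftrightarrow>
    u \<in> free n es \<and> (\<forall>j<length es. \<forall>m\<in>Poly_Mapping.keys (u j). \<exists>l<s. \<sigma> l \<in> Poly_Mapping.keys m)"
proof
  assume "u \<in> var_span s (free n es)"
  moreover have "u \<in> var_span s (free n es) \<Longrightarrow>
     \<forall>j<length es. \<forall>m\<in>Poly_Mapping.keys (u j). \<exists>l<s. \<sigma> l \<in> Poly_Mapping.keys m" for u
  proof (induction s arbitrary: u)
    case (Suc s)
    then obtain w f where *: "w \<in> var_span s (free n es)" "u = w + scal (var (\<sigma> s)) f" by auto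
    show ?case
    proof (intro allI impI ballI)
      fix j m assume j: "j < length es" and "m \<in> Poly_Mapping.keys (u j)"
      then have "m \<in> Poly_Mapping.keys (w j) \<or> m \<in> Poly_Mapping.keys (var (\<sigma> s) * f j)"
        using subsetD[OF Poly_Mapping.keys_add[of "w j" "var (\<sigma> s) * f j"]] *(2) by (auto simp: fun_apply scal_def)
      then show "\<exists>l<Suc s. \<sigma> l \<in> Poly_Mapping.keys m"
      proof
        assume "m \<in> Poly_Mapping.keys (w j)"
        with Suc.IH[OF *(1)] j show ?thesis using less_SucI by blast
      next
        assume "m \<in> Poly_Mapping.keys (var (\<sigma> s) * f j)"
        then obtain t where "m = Poly_Mapping.single (\<sigma> s) 1 + t"
          unfolding var_def by (elim keys_single_times) auto
        then have "\<sigma> s \<in> Poly_Mapping.keys m" by (simp add: in_keys_iff lookup_add)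
        then show ?thesis by auto
      qed
    qed
  qed (simp add: fun_apply)
  ultimately show "u \<in> free n es \<and> (\<forall>j<length es. \<forall>m\<in>Poly_Mapping.keys (u j). \<exists>l<s. \<sigma> l \<in> Poly_Mapping.keys m)"
    using var_span_subset[OF graded_submodule_free assms, of es] by blast
next
  assume *: "u \<in> free n es \<and> (\<forall>j<length es. \<forall>m\<in>Poly_Mapping.keys (u j). \<exists>l<s. \<sigma> l \<in> Poly_Mapping.keys m)"
  note W = graded_submoduleD[OF graded_submodule_var_span[OF graded_submodule_free assms, of es]]
  have mono: "unit_vec j (Poly_Mapping.single m (Poly_Mapping.lookup (u j) m)) \<in> var_span s (free n es)"
    if "j < length es" "m \<in> Poly_Mapping.keys (u j)" for j m
  proof -
    from * that obtain l where l: "l < s" "\<sigma> l \<in> Poly_Mapping.keys m" by blast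
    have "Poly_Mapping.keys m \<subseteq> {..<n}"
      using * that by (auto simp: fun_apply in_free_iff in_polys_iff)
    then obtain q where q: "q \<in> polys n" "Poly_Mapping.single m (Poly_Mapping.lookup (u j) m) = var (\<sigma> l) * q"
      using monomial_as_multiple[OF l(2)] by metis
    have "scal (var (\<sigma> l)) (unit_vec j q) \<in> var_span s (free n es)"
      by (intro var_span_generator[OF graded_submodule_free] unit_vec_free that q l assms)
    moreover have "scal (var (\<sigma> l)) (unit_vec j q) = unit_vec j (var (\<sigma> l) * q)"
      by (auto simp: fun_apply scal_def unit_vec_def fun_eq_iff)
    ultimately show ?thesis using q by simp
  qed
  have "unit_vec j (u j) = (\<Sum>m\<in>Poly_Mapping.keys (u j). unit_vec j (Poly_Mapping.single m (Poly_Mapping.lookup (u j) m)))" for j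
    by (auto simp: fun_apply fun_eq_iff sum_fun_apply unit_vec_def poly_mapping_eq_sum_single[symmetric])
  then have "unit_vec j (u j) \<in> var_span s (free n es)" if "j < length es" for j
    using W(8)[of "Poly_Mapping.keys (u j)", OF mono[OF that]] by simp
  then have "(\<Sum>j<length es. unit_vec j (u j)) \<in> var_span s (free n es)"
    by (intro W(8)) simp
  then show "u \<in> var_span s (free n es)"
    using free_eq_sum_unit_vec[of u n es] * by simp
qed

text \<open>The variables form a regular sequence on a free module, because multiplying a monomial by a new
variable does not make it divisible by an earlier one.\<close>

lemma var_span_free_regular:
  assumes "s < n" "u \<in> free n es" "scal (var (\<sigma> s)) u \<in> var_span s (free n es)"
  shows "u \<in> var_span s (free n es)"
proof -
  have "\<exists>l<s. \<sigma> l \<in> Poly_Mapping.keys m" if j: "j < length es" and m: "m \<in> Poly_Mapping.keys (u j)" for j m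
  proof -
    have "Poly_Mapping.lookup (var (\<sigma> s) * u j) (Poly_Mapping.single (\<sigma> s) 1 + m) = Poly_Mapping.lookup (u j) m"
      unfolding var_def lookup_single_times by simp
    then have "Poly_Mapping.single (\<sigma> s) 1 + m \<in> Poly_Mapping.keys (scal (var (\<sigma> s)) u j)"
      using m by (simp add: in_keys_iff scal_def)
    with assms(1,3) j obtain l where l: "l < s" "\<sigma> l \<in> Poly_Mapping.keys (Poly_Mapping.single (\<sigma> s) 1 + m)"
      by (auto simp: in_var_span_free_iff)
    moreover have "\<sigma> l \<noteq> \<sigma> s" using inj_onD[OF inj_\<sigma>, of l s] l assms(1) by auto
    ultimately show ?thesis by (auto simp: in_keys_iff lookup_add lookup_single)
  qed
  with assms show ?thesis by (auto simp: in_var_span_free_iff)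
qed

text \<open>Beyond the degrees of all generators, only nonconstant monomials occur as coefficients.\<close>

lemma free_deg_in_var_span:
  assumes "u \<in> free_mod_deg n es j" "\<And>e. e \<in> set es \<Longrightarrow> e < j"
  shows "u \<in> var_span n (free n es)"
proof -
  have "\<exists>l<n. \<sigma> l \<in> Poly_Mapping.keys m" if "i < length es" "m \<in> Poly_Mapping.keys (u i)" for i m
  proof -
    from that assms have "int (total_degree m) = j - es ! i" "u i \<in> polys n"
      by (auto simp: in_free_deg_iff in_mpoly_deg_iff)
    moreover have "es ! i < j" using assms(2) that by auto
    ultimately have "m \<noteq> 0" by auto
    then obtain x where x: "x \<in> Poly_Mapping.keys m" using keys_eq_empty by blast
    moreover have "x < n" using \<open>u i \<in> polys n\<close> that x by (auto simp: in_polys_iff)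
    then obtain l where "l < n" "\<sigma> l = x" using range_\<sigma> by (metis imageE lessThan_iff)
    ultimately show ?thesis by auto
  qed
  then show ?thesis using assms(1) by (auto simp: in_var_span_free_iff in_free_deg_iff)
qed

text \<open>Regularity beyond \<open>r\<close> for a submodule \<open>N\<close> of a free module.  The next definition says the same
of the quotient \<open>F/N\<close>, with representatives in \<open>F\<close> in place of cosets.\<close>

definition sub_regular :: "int \<Rightarrow> int list \<Rightarrow> (nat \<Rightarrow> 'k::field mpoly) set \<Rightarrow> bool" where
  "sub_regular r es N \<longleftrightarrow>
     (\<forall>s<n. \<forall>j>r. \<forall>u\<in>N \<inter> free_mod_deg n es j.
        scal (var (\<sigma> s)) u \<in> var_span s N \<longrightarrow> u \<in> var_span s N) \<and>
     (\<forall>j>r. N \<inter> free_mod_deg n es j \<subseteq> var_span n N)"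

definition quot_regular :: "int \<Rightarrow> int list \<Rightarrow> (nat \<Rightarrow> 'k::field mpoly) set \<Rightarrow> bool" where
  "quot_regular r es N \<longleftrightarrow>
     (\<forall>s<n. \<forall>j>r. \<forall>u\<in>free_mod_deg n es j.
        (\<exists>w\<in>var_span s (free n es). scal (var (\<sigma> s)) u - w \<in> N) \<longrightarrow>
        (\<exists>w\<in>var_span s (free n es). u - w \<in> N)) \<and>
     (\<forall>j>r. \<forall>u\<in>free_mod_deg n es j. \<exists>w\<in>var_span n (free n es). u - w \<in> N)"

text \<open>This is the vanishing of \<open>Tor\<^sub>1(R/(y\<^sub>1, \<dots>, y\<^sub>s), F/N)\<close> in degrees greater than \<open>r + 1\<close>, by
induction on \<open>s\<close>.  If \<open>u = w + y\<^sub>s\<^sub>+\<^sub>1 f\<close> lies in \<open>N\<close> with \<open>w\<close> in \<open>(y\<^sub>1, \<dots>, y\<^sub>s)F\<close>, then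
\<open>y\<^sub>s\<^sub>+\<^sub>1 f\<close> vanishes in \<open>F/N\<close> modulo \<open>y\<^sub>1, \<dots>, y\<^sub>s\<close>.  The degree of \<open>f\<close> is greater than \<open>r\<close>, so
by regularity \<open>f\<close> vanishes there as well: up to a change of \<open>w\<close>, it can be replaced by an element
of \<open>N\<close>.\<close>

lemma var_span_free_inter:
  assumes N: "graded_submodule n es N" and reg: "quot_regular r es N"
    and "s \<le> n" "r + 1 < j" "u \<in> N" "u \<in> var_span s (free n es)" "u \<in> free_mod_deg n es j"
  shows "u \<in> var_span s N"
  using assms(3,5-)
proof (induction s arbitrary: u)
  case (Suc s)
  have s: "s < n" using Suc.prems by simp
  note ND = graded_submoduleD[OF N]
  have W: "graded_submodule n es (var_span s (free n es))" "graded_submodule n es (var_span s N)"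
    using graded_submodule_var_span[OF graded_submodule_free[of n es], of s] graded_submodule_var_span[OF N, of s] s by auto
  have v: "var (\<sigma> s) \<in> polys n" using \<sigma>_less[OF s] by auto
  obtain w f where wf: "w \<in> var_span s (free n es)" "w \<in> free_mod_deg n es j"
    "f \<in> free_mod_deg n es (j - 1)" "u = w + scal (var (\<sigma> s)) f"
    using var_span_Suc_homogeneous[OF graded_submodule_free s Suc.prems(3,4)] by blast
  have "scal (var (\<sigma> s)) f - (- w) \<in> N" using wf Suc.prems by (simp add: add.commute)
  moreover have "- w \<in> var_span s (free n es)" using graded_submoduleD(6)[OF W(1)] wf by auto
  ultimately have "\<exists>w\<in>var_span s (free n es). f - w \<in> N"
    using reg wf(3) s \<open>r + 1 < j\<close> unfolding quot_regular_def by (metis less_diff_eq)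
  then obtain g where g: "g \<in> var_span s (free n es)" "f - g \<in> N" by auto
  \<comment> \<open>Only \<open>f\<close> is known to be homogeneous; its two summands are replaced by their components.\<close>
  define v' where "v' = vcomp es (j - 1) (f - g)"
  define g' where "g' = vcomp es (j - 1) g"
  have v': "v' \<in> N" using ND(5) g by (simp add: v'_def)
  have g': "g' \<in> var_span s (free n es)" using graded_submoduleD(5)[OF W(1) g(1)] by (simp add: g'_def)
  have "f = vcomp es (j - 1) ((f - g) + g)" using vcomp_of_deg[OF wf(3)] by simp
  also have "\<dots> = v' + g'" unfolding vcomp_add v'_def g'_def ..
  finally have f: "f = v' + g'" .
  have v'deg: "v' \<in> free_mod_deg n es (j - 1)" unfolding v'_def using g ND(1) by (intro vcomp_free_deg) auto
  define u' where "u' = u - scal (var (\<sigma> s)) v'"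
  have "u' = w + scal (var (\<sigma> s)) g'" by (simp add: u'_def wf(4) f scal_simps)
  then have "u' \<in> var_span s (free n es)"
    using graded_submoduleD(3,4)[OF W(1)] wf(1) g' v by auto
  moreover have "u' \<in> N" unfolding u'_def using ND(4)[OF v v'] ND(7) Suc.prems by auto
  moreover have "u' \<in> free_mod_deg n es j"
    unfolding u'_def using free_deg_scal[OF var_mpoly_deg[OF \<sigma>_less[OF s]] v'deg] Suc.prems
    by (intro free_deg_diff) auto
  ultimately have "u' \<in> var_span s N" using Suc.IH s by auto
  moreover have "u = u' + scal (var (\<sigma> s)) v'" by (simp add: u'_def)
  ultimately show ?case using v' by auto
qed simp

text \<open>In \<open>F\<close> the variables form a regular sequence, and beyond the degrees of the generators every
element is a combination of multiples of variables; \<open>var_span_free_inter\<close> carries both facts over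
to \<open>N\<close>.\<close>

lemma sub_regular_of_quot_regular:
  assumes N: "graded_submodule n es N" and reg: "quot_regular r es N"
    and es: "\<And>e. e \<in> set es \<Longrightarrow> e \<le> r"
  shows "sub_regular (r + 1) es N"
  unfolding sub_regular_def
proof (intro conjI allI impI ballI subsetI)
  fix s j u assume *: "s < n" "r + 1 < j" "u \<in> N \<inter> free_mod_deg n es j" "scal (var (\<sigma> s)) u \<in> var_span s N"
  have sub: "N \<subseteq> free n es" using graded_submoduleD(1)[OF N] by blast
  have "u \<in> var_span s (free n es)"
  proof (rule var_span_free_regular)
    show "scal (var (\<sigma> s)) u \<in> var_span s (free n es)"
      using *(4) var_span_mono[OF sub, of s] by (rule subsetD[rotated])
    show "u \<in> free n es" using *(3) sub by blast
  qed (rule *(1))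
  with * show "u \<in> var_span s N" using var_span_free_inter[OF N reg, of s j u] by simp
next
  fix j u assume *: "r + 1 < j" "u \<in> N \<inter> free_mod_deg n es j"
  have "u \<in> var_span n (free n es)"
    by (rule free_deg_in_var_span[of _ _ j]) (use * es in force)+
  with * show "u \<in> var_span n N" using var_span_free_inter[OF N reg, of n j u] by simp
qed

text \<open>The quotient of the source by the kernel is isomorphic to the image, which is \<open>N\<close>.\<close>

lemma quot_regular_kernel:
  assumes reg: "sub_regular r es N"
    and \<phi>: "\<phi> \<in> graded_hom n (free_mod n es') (free_mod_deg n es') (free_mod n es) (free_mod_deg n es)"
    and img: "\<phi> ` free n es' = N"
  shows "quot_regular r es' {u \<in> free n es'. \<phi> u = 0}"
proof -
  note D = graded_hom_freeD[OF \<phi>]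
  note F = graded_submoduleD[OF graded_submodule_free[of n es']]
  have W: "u \<in> free n es'" if "u \<in> var_span s (free n es')" "s \<le> n" for u :: "nat \<Rightarrow> 'a mpoly" and s
    using var_span_subset[OF graded_submodule_free that(2)] that(1) by auto
  have dF: "u \<in> free n es'" if "u \<in> free_mod_deg n es' j" for u :: "nat \<Rightarrow> 'a mpoly" and j
    using that by (simp add: in_free_deg_iff)
  have lift: "\<exists>w\<in>var_span s (free n es'). u - w \<in> {u \<in> free n es'. \<phi> u = 0}"
    if "\<phi> u \<in> var_span s N" "u \<in> free n es'" "s \<le> n" for s u
  proof -
    from that obtain w where "w \<in> var_span s (free n es')" "\<phi> u = \<phi> w"
      using var_span_image[OF \<phi> \<open>s \<le> n\<close>] img by blast
    moreover from this have "w \<in> free n es'" using W that by blast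
    ultimately show ?thesis using F(7)[OF that(2), of w] D(6)[OF that(2), of w] by auto
  qed
  show ?thesis unfolding quot_regular_def
  proof (intro conjI allI impI ballI)
    fix s j u assume s: "s < n" and j: "r < j" and u: "u \<in> free_mod_deg n es' j"
      and ex: "\<exists>w\<in>var_span s (free n es'). scal (var (\<sigma> s)) u - w \<in> {u \<in> free n es'. \<phi> u = 0}"
    have v: "var (\<sigma> s) \<in> polys n" using \<sigma>_less[OF s] by auto
    from ex obtain w where w: "w \<in> var_span s (free n es')" "\<phi> (scal (var (\<sigma> s)) u - w) = 0" by auto
    then have "scal (var (\<sigma> s)) (\<phi> u) = \<phi> w"
      using D(6)[of "scal (var (\<sigma> s)) u" w] D(3)[OF v dF[OF u]] F(4)[OF v dF[OF u]] W[OF w(1)] s by auto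
    then have "scal (var (\<sigma> s)) (\<phi> u) \<in> var_span s N"
      using var_span_image[OF \<phi>, of s] w(1) s img by auto
    moreover have "\<phi> u \<in> N \<inter> free_mod_deg n es j" using D(4)[OF u] dF[OF u] img by auto
    ultimately have "\<phi> u \<in> var_span s N"
      using reg s j unfolding sub_regular_def by simp
    then show "\<exists>w\<in>var_span s (free n es'). u - w \<in> {u \<in> free n es'. \<phi> u = 0}"
      using lift[OF _ dF[OF u] less_imp_le[OF s]] by blast
  next
    fix j and u :: "nat \<Rightarrow> 'a mpoly" assume j: "r < j" and u: "u \<in> free_mod_deg n es' j"
    have "\<phi> u \<in> N \<inter> free_mod_deg n es j" using D(4)[OF u] dF[OF u] img by auto
    then have "\<phi> u \<in> var_span n N"
      using reg j unfolding sub_regular_def by auto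
    then show "\<exists>w\<in>var_span n (free n es'). u - w \<in> {u \<in> free n es'. \<phi> u = 0}"
      using lift[OF _ dF[OF u] order_refl] by blast
  qed
qed

end


section \<open>Linear resolutions\<close>

lemma graded_hom_kernel_eq:
  "a_kernel (free_mod n es') (free_mod n es) \<phi> = {u \<in> free n es'. \<phi> u = 0}"
  by (simp add: a_kernel_def')

text \<open>A monomial in \<open>n\<close> variables is a function on the indices below \<open>n\<close> whose values are bounded by
the degree.\<close>

lemma finite_monomials: "finite {m. Poly_Mapping.keys m \<subseteq> {..<n} \<and> total_degree m = t}"
proof (rule inj_on_finite)
  let ?S = "{m. Poly_Mapping.keys m \<subseteq> {..<n} \<and> total_degree m = t}"
  show "inj_on (\<lambda>m. restrict (Poly_Mapping.lookup m) {..<n}) ?S"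
  proof (rule inj_onI)
    fix m m' assume *: "m \<in> ?S" "m' \<in> ?S"
      "restrict (Poly_Mapping.lookup m) {..<n} = restrict (Poly_Mapping.lookup m') {..<n}"
    show "m = m'"
    proof (rule poly_mapping_eqI)
      fix i
      show "Poly_Mapping.lookup m i = Poly_Mapping.lookup m' i"
      proof (cases "i < n")
        case True
        then show ?thesis using fun_cong[OF *(3), of i] by simp
      next
        case False
        then have "i \<notin> Poly_Mapping.keys m" "i \<notin> Poly_Mapping.keys m'" using *(1,2) by auto
        then show ?thesis by (simp add: in_keys_iff)
      qed
    qed
  qed
  show "(\<lambda>m. restrict (Poly_Mapping.lookup m) {..<n}) ` ?S \<subseteq> {..<n} \<rightarrow>\<^sub>E {..t}"
  proof (clarsimp simp: PiE_iff)
    fix m :: "nat \<Rightarrow>\<^sub>0 nat" and i assume "Poly_Mapping.keys m \<subseteq> {..<n}" "i < n"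
    then show "Poly_Mapping.lookup m i \<le> total_degree m"
      by (simp add: total_degree_superset[of "{..<n}"] member_le_sum)
  qed
  show "finite ({..<n} \<rightarrow>\<^sub>E {..t})" by (intro finite_PiE) auto
qed

interpretation const_vs: vector_space "\<lambda>c :: 'k::field. scal (Poly_Mapping.single 0 c)"
  by unfold_locales (auto simp: scal_simps single_add mult_single)

lemma free_deg_finite_dim:
  obtains G where "finite G" "free_mod_deg n es r \<subseteq> const_vs.span (G :: (nat \<Rightarrow> 'k::field mpoly) set)"
proof
  define S where "S i = {m. Poly_Mapping.keys m \<subseteq> {..<n} \<and> total_degree m = nat (r - es ! i)}" for i
  let ?G = "(\<Union>i<length es. (\<lambda>m. unit_vec i (Poly_Mapping.single m 1)) ` S i) :: (nat \<Rightarrow> 'k mpoly) set"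
  show "finite ?G" unfolding S_def by (intro finite_UN_I finite_imageI finite_monomials) auto
  show "free_mod_deg n es r \<subseteq> const_vs.span ?G"
  proof
    fix u :: "nat \<Rightarrow> 'k mpoly" assume u: "u \<in> free_mod_deg n es r"
    have "unit_vec i (u i) \<in> const_vs.span ?G" if i: "i < length es" for i
    proof -
      have "unit_vec i (u i) = (\<Sum>m\<in>Poly_Mapping.keys (u i). unit_vec i (Poly_Mapping.single m (Poly_Mapping.lookup (u i) m)))"
        by (auto simp: fun_eq_iff sum_fun_apply unit_vec_def poly_mapping_eq_sum_single[symmetric])
      also have "\<dots> = (\<Sum>m\<in>Poly_Mapping.keys (u i). scal (Poly_Mapping.single 0 (Poly_Mapping.lookup (u i) m)) (unit_vec i (Poly_Mapping.single m 1)))"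
        by (intro sum.cong refl) (auto simp: fun_eq_iff unit_vec_def scal_def mult_single)
      also have "\<dots> \<in> const_vs.span ?G"
      proof (intro const_vs.span_sum const_vs.span_scale const_vs.span_base)
        fix m assume "m \<in> Poly_Mapping.keys (u i)"
        then have "int (total_degree m) = r - es ! i" "Poly_Mapping.keys m \<subseteq> {..<n}"
          using u i by (auto simp: in_free_deg_iff in_mpoly_deg_iff in_polys_iff)
        then have "m \<in> S i" by (simp add: S_def flip: nat_int)
        then show "unit_vec i (Poly_Mapping.single m 1) \<in> ?G" using i by blast
      qed
      finally show ?thesis .
    qed
    then have "(\<Sum>i<length es. unit_vec i (u i)) \<in> const_vs.span ?G"
      by (intro const_vs.span_sum) simp
    moreover have "u = (\<Sum>i<length es. unit_vec i (u i))"
      by (rule free_eq_sum_unit_vec[of u n es]) (use u in \<open>simp add: in_free_deg_iff\<close>)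
    ultimately show "u \<in> const_vs.span ?G" by simp
  qed
qed

lemma hcomp_zero_degree: "hcomp 0 p = Poly_Mapping.single 0 (Poly_Mapping.lookup p 0)"
  by (rule poly_mapping_eqI) (auto simp: lookup_hcomp lookup_single when_def total_degree_eq_0_iff)

context var_order
begin

text \<open>Such a module has a linear resolution: its \<open>i\<close>-th module is generated in degree \<open>r + i\<close>.\<close>

definition linear_submodule :: "int \<Rightarrow> int list \<Rightarrow> (nat \<Rightarrow> 'k::field mpoly) set \<Rightarrow> bool" where
  "linear_submodule r es N \<longleftrightarrow> graded_submodule n es N \<and> sub_regular r es N \<and>
     (\<forall>j<r. N \<inter> free_mod_deg n es j \<subseteq> {0})"

text \<open>One step of a minimal resolution: a free module mapped onto \<open>N\<close> such that no relation between
the images of the basis vectors has a coefficient with a constant term.\<close>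

definition minimal_cover ::
  "int list \<Rightarrow> int list \<Rightarrow> (nat \<Rightarrow> 'k::field mpoly) set \<Rightarrow> ((nat \<Rightarrow> 'k mpoly) \<Rightarrow> (nat \<Rightarrow> 'k mpoly)) \<Rightarrow> bool" where
  "minimal_cover es' es N \<phi> \<longleftrightarrow>
     \<phi> \<in> graded_hom n (free_mod n es') (free_mod_deg n es') (free_mod n es) (free_mod_deg n es) \<and>
     \<phi> ` free n es' = N \<and>
     (\<forall>v\<in>free n es'. \<phi> v = 0 \<longrightarrow> (\<forall>j<length es'. v j \<in> irrelevant_ideal n))"

text \<open>Nakayama's argument.  The image of a basis vector \<open>b\<close> is not zero, since the relation \<open>b\<close> would
have the coefficient \<open>1\<close>; so its degree is at least \<open>r\<close>.  If the degree were larger, the image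
would be a combination of elements of \<open>N\<close> with coefficients in the irrelevant ideal, and lifting
these would give a relation in which \<open>b\<close> has constant coefficient \<open>1\<close>.\<close>

lemma minimal_cover_degrees:
  assumes N: "linear_submodule r es N" and \<phi>: "minimal_cover es' es N \<phi>"
  shows "set es' \<subseteq> {r}"
proof
  fix e assume "e \<in> set es'"
  then obtain i where i: "i < length es'" "e = es' ! i" by (auto simp: in_set_conv_nth)
  have hom: "\<phi> \<in> graded_hom n (free_mod n es') (free_mod_deg n es') (free_mod n es) (free_mod_deg n es)"
    and img: "\<phi> ` free n es' = N"
    and min: "\<And>v j. v \<in> free n es' \<Longrightarrow> \<phi> v = 0 \<Longrightarrow> j < length es' \<Longrightarrow> v j \<in> irrelevant_ideal n"
    using \<phi> by (auto simp: minimal_cover_def)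
  note D = graded_hom_freeD[OF hom]
  define b :: "nat \<Rightarrow> 'a mpoly" where "b = unit_vec i 1"
  have b: "b \<in> free n es'" "b \<in> free_mod_deg n es' e"
    using const_mpoly_deg[of 1 n] i unit_vec_free[OF i(1), of 1 n] by (auto simp: b_def in_free_deg_iff unit_vec_def)
  have \<phi>b: "\<phi> b \<in> N \<inter> free_mod_deg n es e" using D(4)[OF b(2)] b(1) img by auto
  have no_unit: "Poly_Mapping.lookup (u i) 0 = 0" if "u \<in> free n es'" "\<phi> u = 0" for u
    using min[OF that i(1)] by (simp add: in_irrelevant_ideal_iff)
  have "\<phi> b \<noteq> 0" using no_unit[OF b(1)] by (auto simp: b_def unit_vec_def)
  then have "\<not> e < r" using N \<phi>b unfolding linear_submodule_def by blast
  moreover have "\<not> r < e"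
  proof
    assume "r < e"
    then have "\<phi> b \<in> var_span n (\<phi> ` free n es')"
      using N \<phi>b unfolding linear_submodule_def sub_regular_def img by blast
    then obtain w where w: "w \<in> var_span n (free n es')" "\<phi> b = \<phi> w"
      using var_span_image[OF hom order_refl] by blast
    have wF: "w \<in> free n es'" using var_span_subset[OF graded_submodule_free order_refl] w(1) by blast
    have "0 \<notin> Poly_Mapping.keys (w i)"
      using w(1) i(1) by (fastforce simp: in_var_span_free_iff)
    moreover have "Poly_Mapping.lookup ((b - w) i) 0 = 0"
      using graded_submoduleD(7)[OF graded_submodule_free b(1) wF] D(6)[OF b(1) wF] w(2)
      by (intro no_unit) auto
    ultimately show False
      by (simp add: in_keys_iff b_def unit_vec_def minus_apply lookup_minus)
  qed
  ultimately show "e \<in> {r}" by simp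
qed

text \<open>The criterion passes to the kernel by the previous section.  The kernel vanishes in degrees up
to \<open>r\<close>, because its coordinates have no constant term and the basis vectors have degree \<open>r\<close>.\<close>

lemma linear_submodule_syzygy:
  assumes N: "linear_submodule r es N" and \<phi>: "minimal_cover es' es N \<phi>"
  shows "linear_submodule (r + 1) es' {u \<in> free n es'. \<phi> u = 0}"
proof -
  have hom: "\<phi> \<in> graded_hom n (free_mod n es') (free_mod_deg n es') (free_mod n es) (free_mod_deg n es)"
    and img: "\<phi> ` free n es' = N"
    and min: "\<And>v j. v \<in> free n es' \<Longrightarrow> \<phi> v = 0 \<Longrightarrow> j < length es' \<Longrightarrow> v j \<in> irrelevant_ideal n"
    using \<phi> by (auto simp: minimal_cover_def)
  have deg: "e = r" if "e \<in> set es'" for e using minimal_cover_degrees[OF N \<phi>] that by blast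
  have "sub_regular (r + 1) es' {u \<in> free n es'. \<phi> u = 0}"
  proof (rule sub_regular_of_quot_regular)
    show "graded_submodule n es' {u \<in> free n es'. \<phi> u = 0}" by (rule graded_submodule_kernel[OF hom])
    show "quot_regular r es' {u \<in> free n es'. \<phi> u = 0}"
      using N by (intro quot_regular_kernel[OF _ hom img]) (simp add: linear_submodule_def)
  qed (use deg in auto)
  moreover have "u = 0" if u: "u \<in> free n es'" "\<phi> u = 0" "u \<in> free_mod_deg n es' j" and j: "j < r + 1" for u j
  proof
    fix i
    show "u i = 0 i"
    proof (cases "i < length es'")
      case True
      then have "u i \<in> mpoly_deg n (j - r)" "Poly_Mapping.lookup (u i) 0 = 0"
        using deg[of "es' ! i"] u min[of u i] by (auto simp: in_free_deg_iff in_irrelevant_ideal_iff)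
      moreover have "m = 0" if "int (total_degree m) = j - r" for m
        using that j by (simp flip: total_degree_eq_0_iff)
      ultimately have "Poly_Mapping.keys (u i) = {}"
        by (metis (no_types, lifting) all_not_in_conv in_keys_iff in_mpoly_deg_iff)
      then show ?thesis by (simp add: zero_fun_apply)
    qed (use u in \<open>simp add: in_free_iff zero_fun_apply\<close>)
  qed
  ultimately show ?thesis
    using graded_submodule_kernel[OF hom] by (auto simp: linear_submodule_def)
qed

text \<open>A \<open>K\<close>-basis of the component of degree \<open>r\<close> generates \<open>N\<close>: each component of higher degree is
obtained from the preceding one by multiplication with variables.  The cover is minimal because
the constant terms of a relation form a linear relation between basis elements.\<close>

lemma minimal_cover_exists:
  fixes N :: "(nat \<Rightarrow> 'k::field mpoly) set"
  assumes N: "linear_submodule r es N"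
  obtains es' \<phi> where "minimal_cover es' es N \<phi>"
proof -
  have gr: "graded_submodule n es N" using N by (simp add: linear_submodule_def)
  note ND = graded_submoduleD[OF gr]
  obtain B where B: "B \<subseteq> N \<inter> free_mod_deg n es r" "const_vs.independent B"
    "N \<inter> free_mod_deg n es r \<subseteq> const_vs.span B"
    using const_vs.maximal_independent_subset .
  obtain G where G: "finite G" "free_mod_deg n es r \<subseteq> const_vs.span (G :: (nat \<Rightarrow> 'k mpoly) set)"
    using free_deg_finite_dim .
  have "finite B" using const_vs.independent_span_bound[OF G(1) B(2)] B(1) G(2) by blast
  then obtain bs where bs: "set bs = B" "distinct bs" using finite_distinct_list by blast
  define es' where "es' = replicate (length bs) r"
  \<comment> \<open>The basis vectors of the cover, all of degree \<open>r\<close>, are mapped to the chosen basis.\<close>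
  define \<phi> where "\<phi> v = (\<Sum>i<length bs. scal (v i) (bs ! i))" for v :: "nat \<Rightarrow> 'k mpoly"
  have bsN: "bs ! i \<in> N" "bs ! i \<in> free_mod_deg n es r" if "i < length bs" for i
    using that B(1) bs(1) nth_mem by blast+
  have \<phi>N: "\<phi> v \<in> N" if "v \<in> free n es'" for v
    unfolding \<phi>_def using free_coord[OF that] bsN by (intro ND(8) ND(4)) auto
  have hom: "\<phi> \<in> graded_hom n (free_mod n es') (free_mod_deg n es') (free_mod n es) (free_mod_deg n es)"
    unfolding graded_hom_free_iff
  proof (intro conjI ballI allI)
    fix u v :: "nat \<Rightarrow> 'k mpoly"
    show "\<phi> (u + v) = \<phi> u + \<phi> v" by (simp add: \<phi>_def plus_fun_apply scal_simps sum.distrib)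
  next
    fix p and u :: "nat \<Rightarrow> 'k mpoly"
    have "scal p (sum f A) = (\<Sum>x\<in>A. scal p (f x))" for f :: "nat \<Rightarrow> nat \<Rightarrow> 'k mpoly" and A
      by (induction A rule: infinite_finite_induct) (auto simp: scal_simps)
    moreover have "scal (scal p u i) w = scal p (scal (u i) w)" for i w
      by (simp add: scal_simps) (simp add: scal_def)
    ultimately show "\<phi> (scal p u) = scal p (\<phi> u)" by (simp add: \<phi>_def)
  next
    fix j and u :: "nat \<Rightarrow> 'k mpoly" assume u: "u \<in> free_mod_deg n es' j"
    have "(\<Sum>i\<in>A. scal (u i) (bs ! i)) \<in> free_mod_deg n es j" if "A \<subseteq> {..<length bs}" for A
      using finite_subset[OF that finite_lessThan] that
    proof (induction A)
      case empty
      then show ?case by (simp add: in_free_deg_iff in_free_iff zero_fun_apply)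
    next
      case (insert i A)
      then have "u i \<in> mpoly_deg n (j - r)" using u by (auto simp: in_free_deg_iff es'_def)
      from free_deg_scal[OF this bsN(2)[of i]] insert show ?case by (simp add: free_deg_add)
    qed
    then show "\<phi> u \<in> free_mod_deg n es j" by (simp add: \<phi>_def)
  qed (use \<phi>N ND(1) in auto)
  have min: "v j \<in> irrelevant_ideal n" if v: "v \<in> free n es'" "\<phi> v = 0" and j: "j < length es'" for v j
  proof -
    define c where "c i = Poly_Mapping.lookup (v i) 0" for i
    \<comment> \<open>In degree \<open>r\<close> only the constant terms of the coefficients remain.\<close>
    have "0 = vcomp es r (\<phi> v)" using v by simp
    also have "\<dots> = \<phi> (vcomp es' r v)" using graded_hom_freeD(8)[OF hom v(1)] by simp
    also have "\<dots> = (\<Sum>i<length bs. scal (Poly_Mapping.single 0 (c i)) (bs ! i))"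
      unfolding \<phi>_def by (intro sum.cong refl) (simp add: vcomp_def es'_def hcomp_zero_degree c_def)
    also have "\<dots> = (\<Sum>b\<in>(!) bs ` {..<length bs}. scal (Poly_Mapping.single 0 (c (the_inv_into {..<length bs} ((!) bs) b))) b)"
    proof (subst sum.reindex)
      have "inj_on ((!) bs) {..<length bs}" using bs(2) by (auto simp: inj_on_nth)
      then show "inj_on ((!) bs) {..<length bs}"
        "(\<Sum>i<length bs. scal (Poly_Mapping.single 0 (c i)) (bs ! i)) =
          sum ((\<lambda>b. scal (Poly_Mapping.single 0 (c (the_inv_into {..<length bs} ((!) bs) b))) b) \<circ> (!) bs) {..<length bs}"
        by (auto simp: the_inv_into_f_f intro!: sum.cong)
    qed
    finally have *: "(\<Sum>b\<in>B. scal (Poly_Mapping.single 0 (c (the_inv_into {..<length bs} ((!) bs) b))) b) = 0"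
      using bs(1) nth_image[of "length bs" bs] by (simp add: lessThan_atLeast0)
    from const_vs.independentD[OF B(2) \<open>finite B\<close> order_refl *, of "bs ! j"]
    have "c j = 0"
      using j bs inj_on_nth[OF bs(2), of "{..<length bs}"] nth_mem[of j bs]
      by (simp add: es'_def the_inv_into_f_f)
    then show ?thesis using free_coord[OF v(1)] by (simp add: in_irrelevant_ideal_iff c_def)
  qed
  let ?P = "\<phi> ` free n es'"
  note F = graded_submoduleD[OF graded_submodule_free[of n es', where ?'a = 'k]]
  note H = graded_hom_freeD[OF hom]
  have P_add: "x + y \<in> ?P" if xy: "x \<in> ?P" "y \<in> ?P" for x y
  proof -
    obtain u v where "x = \<phi> u" "y = \<phi> v" "u \<in> free n es'" "v \<in> free n es'" using xy by blast
    then show ?thesis using H(2)[of u v] F(3)[of u v] by (metis imageI)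
  qed
  have P_scal: "scal p x \<in> ?P" if x: "x \<in> ?P" and p: "p \<in> polys n" for x p
  proof -
    obtain u where "x = \<phi> u" "u \<in> free n es'" using x by blast
    then show ?thesis using H(3)[OF p, of u] F(4)[OF p, of u] by (metis imageI)
  qed
  have P_0: "0 \<in> ?P" using H(5) F(2) by (metis imageI)
  have P_sum: "sum f A \<in> ?P" if "\<And>x. x \<in> A \<Longrightarrow> f x \<in> ?P" for f :: "'b \<Rightarrow> _" and A
    using that
  proof (induction A rule: infinite_finite_induct)
    case (insert x A)
    then show ?case using P_add[of "f x" "sum f A"] by simp
  qed (use P_0 in simp_all)
  have P_B: "b \<in> ?P" if b: "b \<in> B" for b
  proof -
    obtain i where i: "i < length bs" "b = bs ! i" using b bs(1) by (auto simp: in_set_conv_nth)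
    have "\<phi> (unit_vec i 1) = (\<Sum>l<length bs. if l = i then bs ! l else 0)"
      unfolding \<phi>_def by (intro sum.cong refl) (simp add: unit_vec_def scal_simps)
    then have "\<phi> (unit_vec i 1) = b" using i by simp
    moreover have "unit_vec i 1 \<in> free n es'" using i by (intro unit_vec_free) (auto simp: es'_def)
    ultimately show ?thesis by (metis imageI)
  qed
  have homogeneous: "N \<inter> free_mod_deg n es j \<subseteq> ?P" for j
  proof (induction "nat (j - r)" arbitrary: j)
    case 0
    show ?case
    proof
      fix u assume u: "u \<in> N \<inter> free_mod_deg n es j"
      show "u \<in> ?P"
      proof (cases "j = r")
        case True
        then have "u \<in> const_vs.span B" using u B(3) by blast
        then obtain c where "u = (\<Sum>b\<in>B. scal (Poly_Mapping.single 0 (c b)) b)"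
          using \<open>finite B\<close> by (auto simp: const_vs.span_finite)
        then show ?thesis using P_sum[OF P_scal[OF P_B polys_const]] by simp
      next
        case False
        then have "j < r" using 0 by simp
        then have "u = 0" using N u unfolding linear_submodule_def by blast
        then show ?thesis using P_0 by simp
      qed
    qed
  next
    case (Suc t)
    then have IH: "N \<inter> free_mod_deg n es (j - 1) \<subseteq> ?P" by simp
    have "u \<in> ?P" if "s \<le> n" "u \<in> var_span s N" "u \<in> free_mod_deg n es j" for s u
      using that
    proof (induction s arbitrary: u)
      case 0
      then show ?case using P_0 by simp
    next
      case (Suc s)
      then obtain w f where wf: "w \<in> var_span s N" "w \<in> free_mod_deg n es j" "f \<in> N"
        "f \<in> free_mod_deg n es (j - 1)" "u = w + scal (var (\<sigma> s)) f"
        using var_span_Suc_homogeneous[OF gr, of s u j] by auto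
      have "w \<in> ?P" using Suc.IH[OF _ wf(1,2)] Suc.prems by simp
      moreover have "scal (var (\<sigma> s)) f \<in> ?P"
        using wf(3,4) IH \<sigma>_less[of s] Suc.prems by (intro P_scal) auto
      ultimately show ?case unfolding wf(5) by (rule P_add)
    qed
    moreover have "N \<inter> free_mod_deg n es j \<subseteq> var_span n N"
      using N Suc(2) unfolding linear_submodule_def sub_regular_def by simp
    ultimately show ?case by blast
  qed
  have "N \<subseteq> ?P"
  proof
    fix u assume u: "u \<in> N"
    obtain J where "u = (\<Sum>j\<in>J. vcomp es j u)" using obtain_vcomp_decomposition[OF ND(1)[OF u]] by blast
    moreover have "vcomp es j u \<in> ?P" for j
      using homogeneous ND(5)[OF u] vcomp_free_deg[OF ND(1)[OF u]] by blast
    ultimately show "u \<in> ?P" using P_sum[of J "\<lambda>j. vcomp es j u"] by simp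
  qed
  then have "\<phi> ` free n es' = N" using \<phi>N by blast
  with hom min have "minimal_cover es' es N \<phi>" by (auto simp: minimal_cover_def)
  then show ?thesis using that by blast
qed

text \<open>Dependent choice of the lists of degrees together with the syzygy modules; the maps are
chosen afterwards.\<close>

lemma linear_resolution_exists:
  fixes N :: "(nat \<Rightarrow> 'k::field mpoly) set"
  assumes N: "linear_submodule r es0 N"
  obtains es \<delta> where "es 0 = es0" "minimal_cover (es 1) (es 0) N (\<delta> 0)"
    "\<And>i. minimal_cover (es (Suc (Suc i))) (es (Suc i)) {u \<in> free n (es (Suc i)). \<delta> i u = 0} (\<delta> (Suc i))"
proof -
  define P where "P i x = linear_submodule (r + int i) (fst x) (snd x)" for i and x :: "int list \<times> (nat \<Rightarrow> 'k mpoly) set"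
  define Q where "Q x y \<phi> \<longleftrightarrow> minimal_cover (fst y) (fst x) (snd x) \<phi> \<and> snd y = {u \<in> free n (fst y). \<phi> u = 0}"
    for x y :: "int list \<times> (nat \<Rightarrow> 'k mpoly) set" and \<phi>
  have step: "\<exists>y. P (Suc i) y \<and> (\<exists>\<phi>. Q x y \<phi>)" if Px: "P i x" for i x
  proof -
    obtain es' \<phi> where *: "minimal_cover es' (fst x) (snd x) \<phi>"
      using minimal_cover_exists[OF Px[unfolded P_def]] .
    have "P (Suc i) (es', {u \<in> free n es'. \<phi> u = 0})"
      using linear_submodule_syzygy[OF Px[unfolded P_def] *] by (simp add: P_def add_ac)
    moreover have "Q x (es', {u \<in> free n es'. \<phi> u = 0}) \<phi>" using * by (simp add: Q_def)
    ultimately show ?thesis by blast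
  qed
  have "\<exists>X. \<forall>i. (P i (X i) \<and> (i = 0 \<longrightarrow> X i = (es0, N))) \<and> (\<exists>\<phi>. Q (X i) (X (Suc i)) \<phi>)"
    by (rule dependent_nat_choice[where P = "\<lambda>i x. P i x \<and> (i = 0 \<longrightarrow> x = (es0, N))"])
       (use N step in \<open>auto simp: P_def\<close>)
  then obtain X where X: "X 0 = (es0, N)" "\<And>i. \<exists>\<phi>. Q (X i) (X (Suc i)) \<phi>" by blast
  then obtain \<delta> where \<delta>: "\<And>i. Q (X i) (X (Suc i)) (\<delta> i)" by metis
  show ?thesis
  proof (rule that[of "\<lambda>i. fst (X i)" \<delta>])
    show "minimal_cover (fst (X 1)) (fst (X 0)) N (\<delta> 0)"
      using \<delta>[of 0] X(1) by (simp add: Q_def)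
    show "minimal_cover (fst (X (Suc (Suc i)))) (fst (X (Suc i))) {u \<in> free n (fst (X (Suc i))). \<delta> i u = 0} (\<delta> (Suc i))" for i
      using \<delta>[of i] \<delta>[of "Suc i"] by (simp add: Q_def)
  qed (simp add: X)
qed

lemma linear_resolution_degrees:
  fixes N :: "(nat \<Rightarrow> 'k::field mpoly) set"
  assumes N: "linear_submodule r (es 0) N" "minimal_cover (es 1) (es 0) N (\<delta> 0)"
    and step: "\<And>i. minimal_cover (es (Suc (Suc i))) (es (Suc i)) {u \<in> free n (es (Suc i)). \<delta> i u = 0} (\<delta> (Suc i))"
  shows "set (es (Suc i)) \<subseteq> {r + int i}"
proof -
  have "\<exists>N. linear_submodule (r + int i) (es i) N \<and> minimal_cover (es (Suc i)) (es i) N (\<delta> i)"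
  proof (induction i)
    case (Suc i)
    then obtain N where "linear_submodule (r + int i) (es i) N" "minimal_cover (es (Suc i)) (es i) N (\<delta> i)" by blast
    from linear_submodule_syzygy[OF this] step[of i] show ?case by (auto simp: add_ac)
  qed (use N in auto)
  then show ?thesis using minimal_cover_degrees by blast
qed

end


section \<open>The toric ideal of an arithmetic progression\<close>

lemma lin_indep_over_rat_cancel:
  fixes a d :: "nat ^ 'r::finite"
  assumes "lin_indep_over_rat a d" and eq: "p *s a + q *s d = p' *s a + q' *s d"
  shows "p = p' \<and> q = q'"
proof -
  have ind: "vec.independent {rat_vec a, rat_vec d}" and "a \<noteq> d"
    using assms(1) by (auto simp: lin_indep_over_rat_def)
  then have ne: "rat_vec a \<noteq> rat_vec d" by (auto simp: rat_vec_def vec_eq_iff)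
  define c where "c v = (if v = rat_vec a then of_nat p - of_nat p' else of_nat q - of_nat q' :: rat)" for v
  have "(\<Sum>v\<in>{rat_vec a, rat_vec d}. c v *s v) = 0"
  proof -
    have "of_nat p * of_nat (a $ i) + of_nat q * of_nat (d $ i)
      = of_nat p' * of_nat (a $ i) + (of_nat q' * of_nat (d $ i) :: rat)" for i
      using arg_cong[OF eq, of "\<lambda>v. of_nat (v $ i) :: rat"] by simp
    then have "(of_nat p - of_nat p') *s rat_vec a + (of_nat q - of_nat q') *s rat_vec d = 0"
      by (simp add: rat_vec_def vec_eq_iff algebra_simps)
    then show ?thesis using ne by (simp add: c_def)
  qed
  then have "c v = 0" if "v \<in> {rat_vec a, rat_vec d}" for v
    using vec.independentD[OF ind _ order_refl, of c v] that by simp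
  from this[of "rat_vec a"] this[of "rat_vec d"] ne show ?thesis by (simp add: c_def)
qed

text \<open>The image of \<open>x\<^sub>i\<close> has exponent \<open>a + i d\<close>, so degree and weight of a monomial are the coefficients
of \<open>a\<close> and \<open>d\<close> in the exponent of its image.\<close>

definition weight :: "(nat \<Rightarrow>\<^sub>0 nat) \<Rightarrow> nat" where
  "weight m = (\<Sum>i\<in>Poly_Mapping.keys m. Poly_Mapping.lookup m i * i)"

lemma weight_superset:
  assumes "finite A" "Poly_Mapping.keys m \<subseteq> A"
  shows "weight m = (\<Sum>i\<in>A. Poly_Mapping.lookup m i * i)"
  unfolding weight_def by (rule sum.mono_neutral_left) (use assms in \<open>auto simp: in_keys_iff\<close>)

lemma weight_add: "weight (m + m') = weight m + weight m'"
proof -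
  let ?A = "Poly_Mapping.keys m \<union> Poly_Mapping.keys m'"
  show ?thesis
    by (subst (1 2 3) weight_superset[of ?A])
       (auto simp: lookup_add sum.distrib algebra_simps dest!: subsetD[OF Poly_Mapping.keys_add])
qed

lemma weight_single [simp]: "weight (Poly_Mapping.single i e) = e * i"
  by (simp add: weight_def)

lemma weight_0 [simp]: "weight 0 = 0"
  by (simp add: weight_def)

lemma weight_le: "Poly_Mapping.keys m \<subseteq> {..<Suc k} \<Longrightarrow> weight m \<le> k * total_degree m"
  unfolding weight_def total_degree_def sum_distrib_left
  by (rule sum_mono) (auto simp: mult.commute)

text \<open>Together with \<open>weight_le\<close> this says that the semigroup is the cone \<open>0 \<le> q \<le> k p\<close>.\<close>

lemma monomial_of_degree_weight:
  assumes "q \<le> k * p"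
  obtains m where "Poly_Mapping.keys m \<subseteq> {..<Suc k}" "total_degree m = p" "weight m = q"
proof -
  have "\<exists>m. Poly_Mapping.keys m \<subseteq> {..<Suc k} \<and> total_degree m = p \<and> weight m = q"
    using assms
  proof (induction p arbitrary: q)
    case 0
    then show ?case by (intro exI[of _ 0]) simp
  next
    case (Suc p)
    obtain i q' where iq: "i \<le> k" "q' \<le> k * p" "q = i + q'"
      using that[of 0 q] that[of "q - k * p" "k * p"] Suc.prems by (cases "q \<le> k * p") auto
    then obtain m where "Poly_Mapping.keys m \<subseteq> {..<Suc k}" "total_degree m = p" "weight m = q'"
      using Suc.IH by blast
    with iq show ?case
      by (intro exI[of _ "Poly_Mapping.single i 1 + m"])
         (auto simp: total_degree_add weight_add dest!: subsetD[OF Poly_Mapping.keys_add] split: if_splits)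
  qed
  then show ?thesis using that by blast
qed

lemma monomial_degree_one:
  assumes "total_degree m = 1"
  obtains i where "m = Poly_Mapping.single i 1"
proof -
  have "m \<noteq> 0" using assms by auto
  then obtain i where "i \<in> Poly_Mapping.keys m" using keys_eq_empty by blast
  then obtain m' where "m = Poly_Mapping.single i 1 + m'" using monomial_split by blast
  moreover from this have "m' = 0" using assms by (simp add: total_degree_add total_degree_eq_0_iff)
  ultimately show ?thesis using that by simp
qed

lemma monomial_eq_of_degree_weight:
  assumes "total_degree m \<le> 1" "total_degree m' = total_degree m" "weight m' = weight m"
  shows "m' = m"
proof (cases "total_degree m = 0")
  case True
  then show ?thesis using assms by (simp add: total_degree_eq_0_iff)
next
  case False
  then have "total_degree m = 1" "total_degree m' = 1" using assms by auto
  then show ?thesis using assms(3) by (elim monomial_degree_one) simp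
qed

locale arith_toric =
  fixes a d :: "nat ^ 'r::finite" and k :: nat
  assumes k: "2 \<le> k"
    and cancel: "\<And>p q p' q'. p *s a + q *s d = p' *s a + q' *s d \<Longrightarrow> p = p' \<and> q = q'"
begin

abbreviation T :: "'k::field mpoly \<Rightarrow> (nat ^ 'r) \<Rightarrow>\<^sub>0 'k" where
  "T \<equiv> toric_map (arith_gen a d)"

abbreviation I :: "'k::field mpoly set" where
  "I \<equiv> toric_ideal (Suc k) (arith_gen a d)"

definition exponent :: "(nat \<Rightarrow>\<^sub>0 nat) \<Rightarrow> nat ^ 'r" where
  "exponent m = total_degree m *s a + weight m *s d"

lemma exponent_eq_iff: "exponent m = exponent m' \<longleftrightarrow> total_degree m = total_degree m' \<and> weight m = weight m'"
  using cancel unfolding exponent_def by metis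

lemma T_single: "T (Poly_Mapping.single m c) = Poly_Mapping.single (exponent m) c"
proof -
  have "(\<Sum>i\<in>Poly_Mapping.keys m. Poly_Mapping.lookup m i *s arith_gen a d i) = exponent m"
    by (simp add: vec_eq_iff exponent_def arith_gen_def total_degree_def weight_def sum.distrib
        algebra_simps sum_distrib_right sum_distrib_left)
  then show ?thesis by (simp add: toric_map_single toric_mon_eq mult_single)
qed

lemma T_eq_sum: "T p = (\<Sum>m\<in>Poly_Mapping.keys p. Poly_Mapping.single (exponent m) (Poly_Mapping.lookup p m))"
  by (subst poly_mapping_eq_sum_single) (simp only: toric_map_sum T_single)

lemma lookup_T: "Poly_Mapping.lookup (T p) t = (\<Sum>m\<in>Poly_Mapping.keys p. if exponent m = t then Poly_Mapping.lookup p m else 0)"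
  by (simp add: T_eq_sum lookup_sum lookup_single when_def)

lemma keys_T:
  assumes "t \<in> Poly_Mapping.keys (T p)"
  obtains m where "m \<in> Poly_Mapping.keys p" "t = exponent m"
proof -
  have "\<exists>m\<in>Poly_Mapping.keys p. exponent m = t"
  proof (rule ccontr)
    assume "\<not> (\<exists>m\<in>Poly_Mapping.keys p. exponent m = t)"
    then have "Poly_Mapping.lookup (T p) t = 0" unfolding lookup_T by (intro sum.neutral) auto
    with assms show False by (simp add: in_keys_iff)
  qed
  then show ?thesis using that by blast
qed

lemma T_uminus: "T (- p) = - T p"
  using toric_map_add[of "arith_gen a d" p "- p"] by (simp add: toric_map_zero eq_neg_iff_add_eq_0 add.commute)

lemma T_diff: "T (p - q) = T p - T q"
  using toric_map_add[of "arith_gen a d" p "- q"] by (simp add: T_uminus)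

lemma T_var: "T (var i * p) = Poly_Mapping.single (a + i *s d) 1 * T p"
  by (simp add: toric_map_mult var_def T_single exponent_def Suc_smult_vec)

lemma in_I_iff: "p \<in> I \<longleftrightarrow> p \<in> polys (Suc k) \<and> T p = 0"
  by (simp add: toric_ideal_def a_kernel_def' semigroup_ring_def)

text \<open>If all exponents of \<open>f\<close> lie in \<open>c + S\<close>, then \<open>f\<close> is \<open>t\<^sup>c\<close> times the image of a polynomial.  This
turns divisibility by \<open>x\<^sub>0\<close> or \<open>x\<^sub>k\<close> modulo \<open>I\<close> into a question about exponents.\<close>

lemma T_lift:
  fixes f :: "(nat ^ 'r) \<Rightarrow>\<^sub>0 'k::field"
  assumes "\<And>t. t \<in> Poly_Mapping.keys f \<Longrightarrow> \<exists>m. Poly_Mapping.keys m \<subseteq> {..<Suc k} \<and> t = exponent m + c"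
  obtains p where "p \<in> polys (Suc k)" "f = Poly_Mapping.single c 1 * T p"
proof -
  obtain \<mu> where \<mu>: "\<And>t. t \<in> Poly_Mapping.keys f \<Longrightarrow> Poly_Mapping.keys (\<mu> t) \<subseteq> {..<Suc k} \<and> t = exponent (\<mu> t) + c"
    using assms by metis
  define p where "p = (\<Sum>t\<in>Poly_Mapping.keys f. Poly_Mapping.single (\<mu> t) (Poly_Mapping.lookup f t))"
  have "p \<in> polys (Suc k)" unfolding p_def using \<mu> by (intro polys_sum polys_single) auto
  moreover have "Poly_Mapping.single c 1 * T p
    = (\<Sum>t\<in>Poly_Mapping.keys f. Poly_Mapping.single (exponent (\<mu> t) + c) (Poly_Mapping.lookup f t))"
    by (simp add: p_def toric_map_sum T_single sum_distrib_left mult_single add.commute)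
  then have "Poly_Mapping.single c 1 * T p
    = (\<Sum>t\<in>Poly_Mapping.keys f. Poly_Mapping.single t (Poly_Mapping.lookup f t))"
    using \<mu> by (simp cong: sum.cong)
  then have "f = Poly_Mapping.single c 1 * T p"
    by (subst poly_mapping_eq_sum_single) simp
  ultimately show ?thesis using that by blast
qed

lemma first_var_regular:
  assumes "u \<in> polys (Suc k)" "var 0 * u \<in> I"
  shows "u \<in> I"
proof -
  have "Poly_Mapping.single a 1 * T u = 0"
    using assms(2) T_var[of 0 u] by (simp add: in_I_iff)
  then have "T u = 0" by (rule single_times_cancel)
  with assms show ?thesis by (simp add: in_I_iff)
qed

text \<open>If an exponent \<open>p a + q d\<close> of \<open>T u\<close> satisfies \<open>(p a + q d) + (a + k d) = a + s\<close> with \<open>s\<close> in the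
semigroup, then \<open>q + k \<le> k p\<close>, hence \<open>q \<le> k (p - 1)\<close>, and \<open>a\<close> can be subtracted from it.\<close>

lemma last_var_regular:
  assumes u: "u \<in> polys (Suc k)" and w: "w \<in> polys (Suc k)" and I: "var k * u - var 0 * w \<in> I"
  obtains w' where "w' \<in> polys (Suc k)" "u - var 0 * w' \<in> I"
proof -
  have eq: "Poly_Mapping.single (a + k *s d) 1 * T u = Poly_Mapping.single a 1 * T w"
    using I T_var[of k u] T_var[of 0 w] by (simp add: in_I_iff T_diff)
  have "\<exists>m. Poly_Mapping.keys m \<subseteq> {..<Suc k} \<and> t = exponent m + a" if t: "t \<in> Poly_Mapping.keys (T u)" for t
  proof -
    obtain m where m: "m \<in> Poly_Mapping.keys u" "t = exponent m" using keys_T[OF t] .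
    have "(a + k *s d) + t \<in> Poly_Mapping.keys (Poly_Mapping.single (a + k *s d) 1 * T u)"
      using t unfolding in_keys_iff lookup_single_times by simp
    then obtain t' where "t' \<in> Poly_Mapping.keys (T w)" "(a + k *s d) + t = a + t'"
      unfolding eq by (elim keys_single_times)
    then obtain m' where m': "m' \<in> Poly_Mapping.keys w" "k *s d + exponent m = exponent m'"
      using m(2) by (elim keys_T) (auto simp: add.assoc)
    have "total_degree m *s a + (k + weight m) *s d = total_degree m' *s a + weight m' *s d"
      using m'(2) by (simp add: exponent_def vector_sadd_rdistrib algebra_simps)
    then have "total_degree m = total_degree m'" "k + weight m = weight m'" using cancel by blast+
    moreover have "weight m' \<le> k * total_degree m'"
      using weight_le[of m' k] m'(1) w by (auto simp: in_polys_iff)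
    ultimately have wt: "k + weight m \<le> k * total_degree m" by simp
    then obtain p where p: "total_degree m = Suc p" using k by (cases "total_degree m") auto
    with wt have "weight m \<le> k * p" by simp
    then obtain m'' where m'': "Poly_Mapping.keys m'' \<subseteq> {..<Suc k}" "total_degree m'' = p" "weight m'' = weight m"
      by (elim monomial_of_degree_weight)
    then have "t = exponent m'' + a"
      by (simp add: m(2) exponent_def p Suc_smult_vec add_ac)
    with m'' show ?thesis by blast
  qed
  then obtain w' where "w' \<in> polys (Suc k)" "T u = Poly_Mapping.single a 1 * T w'"
    by (rule T_lift)
  then have "u - var 0 * w' \<in> I" "w' \<in> polys (Suc k)"
    using u T_var[of 0 w'] by (auto simp: in_I_iff T_diff)
  then show ?thesis using that by blast
qed

text \<open>Let \<open>p \<ge> 2\<close> and \<open>q \<le> k p\<close>.  If \<open>q \<le> k (p - 1)\<close>, then \<open>a\<close> can be subtracted from \<open>p a + q d\<close>;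
otherwise \<open>q > k (p - 1) \<ge> k\<close>, and \<open>a + k d\<close> can be subtracted.\<close>

lemma degree_ge_2_in_span:
  assumes u: "u \<in> mpoly_deg (Suc k) j" and j: "1 < j"
  obtains f g where "f \<in> polys (Suc k)" "g \<in> polys (Suc k)" "u - (var 0 * f + var k * g) \<in> I"
proof -
  \<comment> \<open>\<open>F\<close> collects the terms that are divisible by \<open>x\<^sub>0\<close>; all others are divisible by \<open>x\<^sub>k\<close>.\<close>
  define A where "A = {t \<in> Poly_Mapping.keys (T u). \<exists>m. Poly_Mapping.keys m \<subseteq> {..<Suc k} \<and> t = exponent m + a}"
  define F where "F = (\<Sum>t\<in>A. Poly_Mapping.single t (Poly_Mapping.lookup (T u) t))"
  have A: "A \<subseteq> Poly_Mapping.keys (T u)" "finite A" unfolding A_def by auto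
  have lookup_F: "Poly_Mapping.lookup F t = (if t \<in> A then Poly_Mapping.lookup (T u) t else 0)" for t
    using A(2) by (simp add: F_def lookup_sum lookup_single when_def sum.delta)
  have "\<exists>m. Poly_Mapping.keys m \<subseteq> {..<Suc k} \<and> t = exponent m + a" if "t \<in> Poly_Mapping.keys F" for t
    using that by (auto simp: in_keys_iff lookup_F A_def split: if_splits)
  then obtain f where f: "f \<in> polys (Suc k)" "F = Poly_Mapping.single a 1 * T f" by (rule T_lift)
  have "\<exists>m. Poly_Mapping.keys m \<subseteq> {..<Suc k} \<and> t = exponent m + (a + k *s d)"
    if t: "t \<in> Poly_Mapping.keys (T u - F)" for t
  proof -
    from t have tu: "t \<in> Poly_Mapping.keys (T u)" "t \<notin> A"
      by (auto simp: in_keys_iff lookup_minus lookup_F split: if_splits)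
    then obtain m where m: "m \<in> Poly_Mapping.keys u" "t = exponent m" by (elim keys_T)
    have mk: "Poly_Mapping.keys m \<subseteq> {..<Suc k}" and "int (total_degree m) = j"
      using u m(1) by (auto simp: in_mpoly_deg_iff in_polys_iff)
    with j obtain p where p: "total_degree m = Suc p" "1 \<le> p" by (cases "total_degree m") auto
    have "\<not> weight m \<le> k * p"
    proof
      assume "weight m \<le> k * p"
      then obtain m' where "Poly_Mapping.keys m' \<subseteq> {..<Suc k}" "total_degree m' = p" "weight m' = weight m"
        by (elim monomial_of_degree_weight)
      moreover from this have "t = exponent m' + a" by (simp add: m(2) exponent_def p Suc_smult_vec add_ac)
      ultimately show False using tu by (auto simp: A_def)
    qed
    moreover have "k * 1 \<le> k * p" using p(2) by (intro mult_left_mono) auto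
    moreover have "weight m \<le> k + k * p" using weight_le[OF mk] p by simp
    ultimately have wt: "k \<le> weight m" "weight m - k \<le> k * p" by linarith+
    from wt(2) obtain m' where m': "Poly_Mapping.keys m' \<subseteq> {..<Suc k}" "total_degree m' = p" "weight m' = weight m - k"
      by (elim monomial_of_degree_weight)
    have "weight m *s d = (weight m - k) *s d + k *s d"
      using wt(1) by (simp flip: vector_sadd_rdistrib)
    then have "t = exponent m' + (a + k *s d)"
      using m' p by (simp add: m(2) exponent_def Suc_smult_vec add_ac)
    with m' show ?thesis by blast
  qed
  then obtain g where g: "g \<in> polys (Suc k)" "T u - F = Poly_Mapping.single (a + k *s d) 1 * T g" by (rule T_lift)
  have "T (u - (var 0 * f + var k * g)) = 0"
    using f(2) g(2) T_var[of 0 f] T_var[of k g] by (simp add: T_diff toric_map_add algebra_simps)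
  moreover have "u - (var 0 * f + var k * g) \<in> polys (Suc k)"
    using u f(1) g(1) by (intro polys_diff polys_add polys_mult polys_var) (auto simp: in_mpoly_deg_iff)
  ultimately show ?thesis using that f(1) g(1) by (simp add: in_I_iff)
qed

text \<open>The degree of a monomial can be recovered from the exponent of its image, so the homogeneous
components of a polynomial have images with disjoint supports.\<close>

lemma I_hcomp:
  assumes "p \<in> I"
  shows "hcomp j p \<in> I"
proof -
  have "T (hcomp j p) = 0"
  proof (rule poly_mapping_eqI)
    fix t
    show "Poly_Mapping.lookup (T (hcomp j p)) t = Poly_Mapping.lookup 0 t"
    proof (cases "\<exists>m. int (total_degree m) = j \<and> exponent m = t")
      case True
      then obtain m0 where m0: "int (total_degree m0) = j" "exponent m0 = t" by blast
      have "Poly_Mapping.lookup (T (hcomp j p)) t = Poly_Mapping.lookup (T p) t"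
        unfolding lookup_T
      proof (rule sum.mono_neutral_cong_left)
        show "\<forall>m\<in>Poly_Mapping.keys p - Poly_Mapping.keys (hcomp j p).
            (if exponent m = t then Poly_Mapping.lookup p m else 0) = 0"
          using m0 by (auto simp: keys_hcomp exponent_eq_iff)
      qed (auto simp: keys_hcomp lookup_hcomp)
      then show ?thesis using assms by (simp add: in_I_iff)
    next
      case False
      then show ?thesis unfolding lookup_T by (auto simp: keys_hcomp intro!: sum.neutral)
    qed
  qed
  moreover have "hcomp j p \<in> polys (Suc k)"
    using assms hcomp_mpoly_deg[of p "Suc k" j] by (simp add: in_I_iff in_mpoly_deg_iff)
  ultimately show ?thesis by (simp add: in_I_iff)
qed

text \<open>Monomials of degree at most \<open>1\<close> have distinct images.\<close>

lemma I_low_degree: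
  assumes "p \<in> I" "p \<in> mpoly_deg (Suc k) j" "j < 2"
  shows "p = 0"
proof (rule poly_mapping_eqI)
  fix m
  show "Poly_Mapping.lookup p m = Poly_Mapping.lookup 0 m"
  proof (cases "m \<in> Poly_Mapping.keys p")
    case True
    have deg: "int (total_degree m') = j" if "m' \<in> Poly_Mapping.keys p" for m'
      using assms(2) that by (auto simp: in_mpoly_deg_iff)
    have "m' = m" if "m' \<in> Poly_Mapping.keys p" "exponent m' = exponent m" for m'
      using that deg[OF True] assms(3)
      by (intro monomial_eq_of_degree_weight) (auto simp: exponent_eq_iff)
    then have "Poly_Mapping.lookup (T p) (exponent m) = (\<Sum>m'\<in>Poly_Mapping.keys p. if m' = m then Poly_Mapping.lookup p m' else 0)"
      unfolding lookup_T by (intro sum.cong) auto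
    also have "\<dots> = Poly_Mapping.lookup p m" using True by simp
    finally show ?thesis using assms(1) by (simp add: in_I_iff)
  qed (simp add: in_keys_iff)
qed

lemma I_const_coeff: "p \<in> I \<Longrightarrow> Poly_Mapping.lookup p 0 = 0"
  using I_low_degree[OF I_hcomp[of p 0], of 0] hcomp_mpoly_deg[of p "Suc k" 0]
  by (simp add: in_I_iff hcomp_zero_degree) (metis lookup_single_eq lookup_zero)

lemma I_nonzero: "\<exists>p \<in> I. p \<noteq> (0 :: 'k::field mpoly)"
proof (intro bexI)
  \<comment> \<open>This quadric needs the variable \<open>x\<^sub>2\<close>, hence \<open>k \<ge> 2\<close>.\<close>
  let ?p = "var 0 * var 2 - var 1 * var 1 :: 'k mpoly"
  have "Poly_Mapping.single 0 1 + Poly_Mapping.single 2 1 \<noteq> Poly_Mapping.single 1 1 + (Poly_Mapping.single 1 1 :: nat \<Rightarrow>\<^sub>0 nat)"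
    by (auto simp: poly_mapping_eq_iff fun_eq_iff lookup_add lookup_single when_def intro!: exI[of _ 1])
  then have "Poly_Mapping.lookup ?p (Poly_Mapping.single 0 1 + Poly_Mapping.single 2 1) = 1"
    by (simp add: var_def mult_single lookup_minus lookup_single when_def)
  then show "?p \<noteq> 0" by (metis lookup_zero zero_neq_one)
  have "T ?p = 0"
    unfolding T_diff var_def mult_single T_single
    by (simp add: exponent_def total_degree_add weight_add)
  then show "?p \<in> I" using k by (auto simp: in_I_iff intro!: polys_diff polys_mult polys_var)
qed


text \<open>The order \<open>x\<^sub>0, x\<^sub>k, x\<^sub>1, \<dots>, x\<^sub>k\<^sub>-\<^sub>1\<close>.\<close>

definition var_perm :: "nat \<Rightarrow> nat" where
  "var_perm s = (if s = 0 then 0 else if s = 1 then k else s - 1)"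

sublocale var_order "Suc k" var_perm
proof
  show inj: "inj_on var_perm {..<Suc k}"
    using k by (auto simp: inj_on_def var_perm_def)
  have "var_perm ` {..<Suc k} \<subseteq> {..<Suc k}" using k by (auto simp: var_perm_def)
  then show "var_perm ` {..<Suc k} = {..<Suc k}"
    using inj by (intro endo_inj_surj) auto
qed

text \<open>The ideal as a submodule of the free module of rank one.\<close>

definition I_vec :: "(nat \<Rightarrow> 'k::field mpoly) set" where
  "I_vec = {v \<in> free (Suc k) [0]. v 0 \<in> I}"

lemma graded_submodule_I_vec: "graded_submodule (Suc k) [0] I_vec"
  unfolding graded_submodule_def
proof (intro conjI ballI allI)
  note F = graded_submoduleD[OF graded_submodule_free[of "Suc k" "[0]"]]
  show "I_vec \<subseteq> free (Suc k) [0]" by (auto simp: I_vec_def)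
  show "0 \<in> I_vec" using F(2) by (simp add: I_vec_def in_I_iff toric_map_zero zero_fun_apply)
  show "u + v \<in> I_vec" if "u \<in> I_vec" "v \<in> I_vec" for u v
    using that F(3) by (auto simp: I_vec_def in_I_iff toric_map_add plus_fun_apply)
  show "scal p u \<in> I_vec" if "p \<in> polys (Suc k)" "u \<in> I_vec" for p u
    using that F(4)[of p u] by (auto simp: I_vec_def in_I_iff toric_map_mult scal_def)
  show "vcomp [0] j u \<in> I_vec" if "u \<in> I_vec" for j u
    using that F(5)[of u j] I_hcomp[of "u 0" j] by (auto simp: I_vec_def vcomp_def)
qed

text \<open>The first two steps hold in all degrees since \<open>x\<^sub>0, x\<^sub>k\<close> is a regular sequence on \<open>R/I\<close>.  From the
third step on there is nothing left in degrees greater than \<open>1\<close>, as \<open>R/(I, x\<^sub>0, x\<^sub>k)\<close> vanishes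
there.\<close>

lemma quot_regular_I_vec: "quot_regular 1 [0] (I_vec :: (nat \<Rightarrow> 'k::field mpoly) set)"
proof -
  let ?F = "free (Suc k) [0] :: (nat \<Rightarrow> 'k mpoly) set"
  note F = graded_submoduleD[OF graded_submodule_free[of "Suc k" "[0]", where ?'a = 'k]]
  have uv: "unit_vec 0 p \<in> ?F" if "p \<in> polys (Suc k)" for p using that by (simp add: unit_vec_free)
  have span2: "\<exists>w\<in>var_span s ?F. u - w \<in> I_vec"
    if u: "u \<in> free_mod_deg (Suc k) [0] j" and j: "1 < j" and s: "2 \<le> s" "s \<le> Suc k" for u j s
  proof -
    from u have uF: "u \<in> ?F" and "u 0 \<in> mpoly_deg (Suc k) j" by (auto simp: in_free_deg_iff)
    then obtain f g where fg: "f \<in> polys (Suc k)" "g \<in> polys (Suc k)" "u 0 - (var 0 * f + var k * g) \<in> I"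
      using j by (elim degree_ge_2_in_span)
    let ?w = "scal (var (var_perm 0)) (unit_vec 0 f) + scal (var (var_perm 1)) (unit_vec 0 g)"
    have "?w \<in> var_span s ?F"
      using s fg by (intro graded_submoduleD(3)[OF graded_submodule_var_span[OF graded_submodule_free]]
        var_span_generator[OF graded_submodule_free] uv) auto
    moreover from this have "?w \<in> ?F" using var_span_subset[OF graded_submodule_free] s by blast
    then have "u - ?w \<in> I_vec"
      using fg(3) F(7)[OF uF] by (simp add: I_vec_def minus_apply plus_fun_apply scal_def unit_vec_def var_perm_def)
    ultimately show ?thesis by blast
  qed
  show ?thesis unfolding quot_regular_def
  proof (intro conjI allI impI ballI)
    fix s j u
    assume s: "s < Suc k" and j: "1 < j" and u: "u \<in> free_mod_deg (Suc k) [0] j"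
      and "\<exists>w\<in>var_span s ?F. scal (var (var_perm s)) u - w \<in> I_vec"
    then obtain w where w: "w \<in> var_span s ?F" "scal (var (var_perm s)) u - w \<in> I_vec" by blast
    have uF: "u \<in> ?F" using u by (simp add: in_free_deg_iff)
    have u0: "u 0 \<in> polys (Suc k)" using free_coord[OF uF] .
    consider "s = 0" | "s = 1" | "2 \<le> s" by linarith
    then show "\<exists>w\<in>var_span s ?F. u - w \<in> I_vec"
    proof cases
      case 1
      then have "var 0 * u 0 \<in> I" using w by (simp add: I_vec_def var_perm_def scal_def)
      then have "u \<in> I_vec" using first_var_regular[OF u0] uF by (simp add: I_vec_def)
      then show ?thesis using 1 by simp
    next
      case 2
      then obtain f where f: "f \<in> ?F" "w = scal (var 0) f" using w(1) by (auto simp: var_perm_def)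
      then have "var k * u 0 - var 0 * f 0 \<in> I"
        using w(2) 2 by (simp add: I_vec_def var_perm_def scal_def minus_apply)
      then obtain w' where w': "w' \<in> polys (Suc k)" "u 0 - var 0 * w' \<in> I"
        using last_var_regular[OF u0 free_coord[OF f(1)]] by blast
      have v0: "var 0 \<in> polys (Suc k)" by auto
      have "u - scal (var 0) (unit_vec 0 w') \<in> I_vec"
        using w'(2) F(7)[OF uF F(4)[OF v0 uv[OF w'(1)]]]
        by (simp add: I_vec_def minus_apply scal_def unit_vec_def)
      moreover have "scal (var 0) (unit_vec 0 w') \<in> var_span s ?F"
        using var_span_generator[OF graded_submodule_free _ _ uv[OF w'(1)], of 0 s] 2 by (simp add: var_perm_def)
      ultimately show ?thesis by blast
    next
      case 3
      then show ?thesis using span2 u j s by simp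
    qed
  next
    fix j and u :: "nat \<Rightarrow> 'k mpoly" assume "1 < j" "u \<in> free_mod_deg (Suc k) [0] j"
    then show "\<exists>w\<in>var_span (Suc k) ?F. u - w \<in> I_vec" using span2[of u j "Suc k"] k by simp
  qed
qed

lemma linear_submodule_I_vec: "linear_submodule 2 [0] (I_vec :: (nat \<Rightarrow> 'k::field mpoly) set)"
  unfolding linear_submodule_def
proof (intro conjI allI impI subsetI)
  show "graded_submodule (Suc k) [0] (I_vec :: (nat \<Rightarrow> 'k mpoly) set)" by (rule graded_submodule_I_vec)
  have "sub_regular (1 + 1) [0] (I_vec :: (nat \<Rightarrow> 'k mpoly) set)"
    by (rule sub_regular_of_quot_regular[OF graded_submodule_I_vec quot_regular_I_vec]) simp
  then show "sub_regular 2 [0] (I_vec :: (nat \<Rightarrow> 'k mpoly) set)" by simp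
next
  fix j and v :: "nat \<Rightarrow> 'k mpoly" assume j: "j < 2" and v: "v \<in> I_vec \<inter> free_mod_deg (Suc k) [0] j"
  then have "v 0 = 0" using I_low_degree[of "v 0" j] by (auto simp: I_vec_def in_free_deg_iff)
  moreover have "v i = 0" if "i \<noteq> 0" for i using v that by (auto simp: I_vec_def in_free_iff)
  ultimately have "v = 0" by (metis ext zero_fun_apply)
  then show "v \<in> {0}" by simp
qed

lemma I_vec_nonzero: "\<exists>v \<in> I_vec. v \<noteq> (0 :: nat \<Rightarrow> 'k::field mpoly)"
proof -
  obtain p where p: "p \<in> I" "p \<noteq> (0 :: 'k mpoly)" using I_nonzero by blast
  have "unit_vec 0 p \<in> free (Suc k) [0]" using p(1) by (intro unit_vec_free) (auto simp: in_I_iff)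
  then have "unit_vec 0 p \<in> I_vec" using p(1) by (simp add: I_vec_def) (simp add: unit_vec_def)
  moreover have "unit_vec 0 p \<noteq> 0" using p(2) by (metis unit_vec_def zero_fun_apply)
  ultimately show ?thesis by blast
qed

end


section \<open>The graded module defined by a homogeneous ideal\<close>

lemma mpoly_ring_simps [simp]:
  "mult (mpoly_ring n) = (*)" "one (mpoly_ring n) = 1" "zero (mpoly_ring n) = 0" "add (mpoly_ring n) = (+)"
  by (simp_all add: mpoly_ring_def)

locale homogeneous_ideal =
  fixes n :: nat and I :: "'k::field mpoly set"
  assumes ideal: "ideal I (mpoly_ring n)"
    and hcomp_closed: "\<And>p j. p \<in> I \<Longrightarrow> hcomp j p \<in> I"
begin

sublocale ideal I "mpoly_ring n :: 'k mpoly ring"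
  rewrites "mult (mpoly_ring n :: 'k mpoly ring) = (*)" and "one (mpoly_ring n :: 'k mpoly ring) = 1"
    and "zero (mpoly_ring n :: 'k mpoly ring) = 0" and "add (mpoly_ring n :: 'k mpoly ring) = (+)"
  by (rule ideal) simp_all

abbreviation coset :: "'k mpoly \<Rightarrow> 'k mpoly set" where
  "coset p \<equiv> I +>\<^bsub>mpoly_ring n\<^esub> p"

abbreviation M :: "('k mpoly, 'k mpoly set) module" where
  "M \<equiv> quotient_module n I"

lemma I_0: "0 \<in> I"
  using zero_closed by simp

lemma I_add: "p \<in> I \<Longrightarrow> q \<in> I \<Longrightarrow> p + q \<in> I"
  using a_closed by simp

lemma I_mult: "p \<in> I \<Longrightarrow> q \<in> polys n \<Longrightarrow> q * p \<in> I"
  using I_l_closed by simp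

lemma I_uminus: "p \<in> I \<Longrightarrow> - p \<in> I"
  using I_mult[of p "- 1"] by auto

lemma I_diff: "p \<in> I \<Longrightarrow> q \<in> I \<Longrightarrow> p - q \<in> I"
  using I_add[of p "- q"] I_uminus[of q] by simp

lemma I_sum: "(\<And>x. x \<in> A \<Longrightarrow> f x \<in> I) \<Longrightarrow> sum f A \<in> I"
  by (induction A rule: infinite_finite_induct) (auto intro: I_0 I_add)

lemma coset_eq_iff: "coset p = coset q \<longleftrightarrow> p - q \<in> I"
proof -
  have coset: "coset p = {h + p | h. h \<in> I}" for p by (auto simp: a_r_coset_def')
  show ?thesis
  proof
    assume "coset p = coset q"
    moreover have "0 + p \<in> coset p" unfolding coset using I_0 by blast
    ultimately obtain h where "h \<in> I" "0 + p = h + q" unfolding coset by blast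
    then show "p - q \<in> I" by simp
  next
    assume *: "p - q \<in> I"
    show "coset p = coset q" unfolding coset
    proof (intro equalityI subsetI)
      fix x assume "x \<in> {h + p | h. h \<in> I}"
      then obtain h where "h \<in> I" "x = h + p" by blast
      then show "x \<in> {h + q | h. h \<in> I}"
        using I_add[OF \<open>h \<in> I\<close> *] by (intro CollectI exI[of _ "h + (p - q)"]) simp
    next
      fix x assume "x \<in> {h + q | h. h \<in> I}"
      then obtain h where "h \<in> I" "x = h + q" by blast
      then show "x \<in> {h + p | h. h \<in> I}"
        using I_diff[OF \<open>h \<in> I\<close> *] by (intro CollectI exI[of _ "h - (p - q)"]) simp
    qed
  qed
qed

lemma coset_0: "coset 0 = I"
  by (auto simp: a_r_coset_def')

lemma coset_eq_zero_iff: "coset p = I \<longleftrightarrow> p \<in> I"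
  using coset_eq_iff[of p 0] by (simp add: coset_0)

lemma M_carrier: "carrier M = coset ` polys n"
  unfolding quotient_module_def FactRing_def A_RCOSETS_def' partial_object.simps by blast

lemma M_zero: "zero M = I"
  by (simp add: quotient_module_def FactRing_def)

lemma M_add: "p \<in> polys n \<Longrightarrow> q \<in> polys n \<Longrightarrow> coset p \<oplus>\<^bsub>M\<^esub> coset q = coset (p + q)"
  using a_rcos_sum[of p q] by (simp add: quotient_module_def FactRing_def)

lemma M_smult: "p \<in> polys n \<Longrightarrow> q \<in> polys n \<Longrightarrow> p \<odot>\<^bsub>M\<^esub> coset q = coset (p * q)"
  using rcoset_mult_add[of p q] by (simp add: quotient_module_def FactRing_def)

lemma abelian_group_M: "abelian_group M"
proof (rule abelian_groupI)
  fix x assume "x \<in> carrier M"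
  then obtain p where "p \<in> polys n" "x = coset p" by (auto simp: M_carrier)
  then have "coset (- p) \<oplus>\<^bsub>M\<^esub> x = \<zero>\<^bsub>M\<^esub>" "coset (- p) \<in> carrier M"
    using M_add[of "- p" p] by (auto simp: M_zero M_carrier coset_0)
  then show "\<exists>y\<in>carrier M. y \<oplus>\<^bsub>M\<^esub> x = \<zero>\<^bsub>M\<^esub>" by blast
next
  show "\<zero>\<^bsub>M\<^esub> \<in> carrier M" using coset_0 by (auto simp: M_zero M_carrier)
next
  fix x assume "x \<in> carrier M"
  then obtain p where "p \<in> polys n" "x = coset p" by (auto simp: M_carrier)
  then show "\<zero>\<^bsub>M\<^esub> \<oplus>\<^bsub>M\<^esub> x = x" using M_add[of 0 p] by (simp add: M_zero coset_0)
qed (auto simp: M_carrier M_add add_ac polys_add)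

lemma module_M: "Module.module (mpoly_ring n) M"
  by (rule moduleI[OF mpoly_ring_cring abelian_group_M])
     (auto simp: M_carrier M_add M_smult algebra_simps polys_add polys_mult)

lemma M_finsum:
  assumes "finite A" "\<And>x. x \<in> A \<Longrightarrow> f x \<in> polys n"
  shows "(\<Oplus>\<^bsub>M\<^esub>x\<in>A. coset (f x)) = coset (\<Sum>x\<in>A. f x)"
proof -
  interpret M: abelian_group M by (rule abelian_group_M)
  show ?thesis
    using assms
  proof (induction A)
    case empty
    then show ?case by (simp add: M_zero coset_0)
  next
    case (insert x A)
    have "(\<Oplus>\<^bsub>M\<^esub>x\<in>insert x A. coset (f x)) = coset (f x) \<oplus>\<^bsub>M\<^esub> (\<Oplus>\<^bsub>M\<^esub>x\<in>A. coset (f x))"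
      using insert by (intro M.finsum_insert) (auto simp: M_carrier)
    then show ?case using insert M_add[of "f x" "sum f A"] by (simp add: polys_sum)
  qed
qed

text \<open>A decomposition of the coset of \<open>p\<close> into homogeneous cosets gives a polynomial that differs from
\<open>p\<close> by an element of \<open>I\<close>; as \<open>I\<close> is homogeneous, the components then agree modulo \<open>I\<close>.\<close>

lemma graded_module_M: "graded_module n M (quotient_deg n I)"
proof -
  interpret M: Module.module "mpoly_ring n :: 'k mpoly ring" M by (rule module_M)
  have deg_polys: "p \<in> polys n" if "p \<in> mpoly_deg n j" for p :: "'k mpoly" and j using that by (simp add: in_mpoly_deg_iff)
  have "subgroup (quotient_deg n I j) (add_monoid M)" for j
  proof (rule M.add.subgroupI)
    fix x assume "x \<in> quotient_deg n I j"
    then obtain p where p: "p \<in> mpoly_deg n j" "x = coset p" by (auto simp: quotient_deg_def)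
    have "\<ominus>\<^bsub>M\<^esub> x = coset (- p)"
      by (rule M.minus_equality) (use p M_add[of "- p" p] deg_polys[OF p(1)] in \<open>auto simp: M_carrier M_zero coset_0\<close>)
    then show "\<ominus>\<^bsub>M\<^esub> x \<in> quotient_deg n I j" using p by (auto simp: quotient_deg_def)
  next
    fix x y assume "x \<in> quotient_deg n I j" "y \<in> quotient_deg n I j"
    then obtain p q where "p \<in> mpoly_deg n j" "q \<in> mpoly_deg n j" "x = coset p" "y = coset q"
      by (auto simp: quotient_deg_def)
    then show "x \<oplus>\<^bsub>M\<^esub> y \<in> quotient_deg n I j"
      using M_add[of p q] deg_polys by (auto simp: quotient_deg_def)
  next
    show "quotient_deg n I j \<noteq> {}" by (auto simp: quotient_deg_def)
  qed (auto simp: quotient_deg_def M_carrier deg_polys)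
  then have subgr: "additive_subgroup (quotient_deg n I j) M" for j by (rule additive_subgroupI)
  have "p \<odot>\<^bsub>M\<^esub> x \<in> quotient_deg n I (i + j)" if p: "p \<in> mpoly_deg n i" and x: "x \<in> quotient_deg n I j" for i j p x
  proof -
    obtain q where q: "q \<in> mpoly_deg n j" "x = coset q" using x by (auto simp: quotient_deg_def)
    then have "p \<odot>\<^bsub>M\<^esub> x = coset (p * q)" using M_smult[OF deg_polys[OF p] deg_polys[OF q(1)]] by simp
    then show ?thesis using mpoly_deg_mult[OF p q(1)] by (simp add: quotient_deg_def)
  qed
  moreover have "\<exists>!c. (\<forall>i. c i \<in> quotient_deg n I i) \<and> finite {i. c i \<noteq> \<zero>\<^bsub>M\<^esub>} \<and>
      x = (\<Oplus>\<^bsub>M\<^esub>i\<in>{i. c i \<noteq> \<zero>\<^bsub>M\<^esub>}. c i)" if x: "x \<in> carrier M" for x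
  proof -
    from x obtain p where p: "p \<in> polys n" "x = coset p" by (auto simp: M_carrier)
    have hp: "hcomp i p \<in> polys n" for i using hcomp_mpoly_deg[OF p(1)] deg_polys by blast
    define J where "J = (\<lambda>m. int (total_degree m)) ` Poly_Mapping.keys p"
    have pJ: "(\<Sum>i\<in>J. hcomp i p) = p" by (rule sum_hcomp) (auto simp: J_def)
    \<comment> \<open>Some components of \<open>p\<close> may lie in \<open>I\<close>; they drop out of the decomposition.\<close>
    define J' where "J' = {i. coset (hcomp i p) \<noteq> \<zero>\<^bsub>M\<^esub>}"
    have J': "i \<notin> J' \<longleftrightarrow> hcomp i p \<in> I" for i by (simp add: J'_def M_zero coset_eq_zero_iff)
    have "hcomp i p = 0" if "i \<notin> J" for i using that by (intro hcomp_eq_0) (auto simp: J_def)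
    then have J'J: "J' \<subseteq> J" using J' I_0 by (metis subsetI)
    then have fin: "finite J'" by (rule finite_subset) (simp add: J_def)
    have "p = (\<Sum>i\<in>J'. hcomp i p) + (\<Sum>i\<in>J - J'. hcomp i p)"
      using sum.subset_diff[OF J'J, of "\<lambda>i. hcomp i p"] pJ by (simp add: J_def add.commute)
    moreover have "(\<Sum>i\<in>J - J'. hcomp i p) \<in> I" using J' by (intro I_sum) auto
    ultimately have "p - (\<Sum>i\<in>J'. hcomp i p) \<in> I" by (metis add_diff_cancel_left')
    then have ex: "x = (\<Oplus>\<^bsub>M\<^esub>i\<in>J'. coset (hcomp i p))"
      using M_finsum[OF fin, of "\<lambda>i. hcomp i p"] hp p(2) by (simp add: coset_eq_iff)
    show ?thesis
    proof (rule ex1I[of _ "\<lambda>i. coset (hcomp i p)"])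
      show "(\<forall>i. coset (hcomp i p) \<in> quotient_deg n I i) \<and> finite {i. coset (hcomp i p) \<noteq> \<zero>\<^bsub>M\<^esub>} \<and>
          x = (\<Oplus>\<^bsub>M\<^esub>i\<in>{i. coset (hcomp i p) \<noteq> \<zero>\<^bsub>M\<^esub>}. coset (hcomp i p))"
        using ex fin hcomp_mpoly_deg[OF p(1)] unfolding J'_def quotient_deg_def by blast
    next
      fix c assume c: "(\<forall>i. c i \<in> quotient_deg n I i) \<and> finite {i. c i \<noteq> \<zero>\<^bsub>M\<^esub>} \<and>
        x = (\<Oplus>\<^bsub>M\<^esub>i\<in>{i. c i \<noteq> \<zero>\<^bsub>M\<^esub>}. c i)"
      then have "\<forall>i. \<exists>q. q \<in> mpoly_deg n i \<and> c i = coset q" by (auto simp: quotient_deg_def)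
      then obtain q where q: "\<And>i. q i \<in> mpoly_deg n i" "\<And>i. c i = coset (q i)" by metis
      let ?S = "{i. c i \<noteq> \<zero>\<^bsub>M\<^esub>}"
      have "coset p = coset (\<Sum>i\<in>?S. q i)"
        using c M_finsum[of ?S q] deg_polys[OF q(1)] p(2) by (simp add: q(2))
      then have "hcomp j (p - (\<Sum>i\<in>?S. q i)) \<in> I" for j
        by (intro hcomp_closed) (simp add: coset_eq_iff)
      moreover have "hcomp j (\<Sum>i\<in>?S. q i) = (if j \<in> ?S then q j else 0)" for j
        using c by (simp add: hcomp_sum hcomp_of_deg[OF q(1)])
      ultimately have *: "hcomp j p - (if j \<in> ?S then q j else 0) \<in> I" for j
        by (simp add: hcomp_diff)
      have "coset (hcomp j p) = c j" for j
      proof (cases "j \<in> ?S")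
        case True
        then show ?thesis using *[of j] by (simp add: q(2) coset_eq_iff)
      next
        case False
        then show ?thesis using *[of j] by (simp add: M_zero coset_eq_zero_iff)
      qed
      then show "c = (\<lambda>i. coset (hcomp i p))" by auto
    qed
  qed
  ultimately show ?thesis unfolding graded_module_def using module_M subgr by blast
qed

end


section \<open>The regularity of the semigroup ring\<close>

context arith_toric
begin

lemma homogeneous_ideal_I: "homogeneous_ideal (Suc k) (I :: 'k::field mpoly set)"
proof (rule homogeneous_ideal.intro)
  interpret ring_hom_ring "mpoly_ring (Suc k) :: 'k mpoly ring"
    "semigroup_ring (affine_semigroup (arith_gen a d ` {..<Suc k})) :: ((nat ^ 'r) \<Rightarrow>\<^sub>0 'k) ring" T
    by (intro ring_hom_ringI2 toric_map_hom cring.axioms(1) mpoly_ring_cring semigroup_ring_cring)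
  show "ideal (I :: 'k mpoly set) (mpoly_ring (Suc k))"
    unfolding toric_ideal_def by (rule kernel_is_ideal)
qed (rule I_hcomp)

text \<open>The basis vector \<open>b\<close> number \<open>j\<close> is mapped to the coset of some form \<open>p\<close>.  Let \<open>v\<close> be a
preimage of \<open>1\<close>.  Then \<open>b - p v\<close> is a relation, so its \<open>j\<close>-th coordinate has no constant term,
which is possible only if \<open>p\<close> is a nonzero constant.  Two basis vectors with constant images
would satisfy a relation with constant coefficients.  So there is exactly one, and it is mapped
to a unit multiple of \<open>1\<close>.\<close>

lemma augmentation_minimal:
  fixes \<epsilon> :: "(nat \<Rightarrow> 'k::field mpoly) \<Rightarrow> 'k mpoly set"
  assumes \<epsilon>: "\<epsilon> \<in> graded_hom (Suc k) (free_mod (Suc k) es) (free_mod_deg (Suc k) es)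
      (quotient_module (Suc k) I) (quotient_deg (Suc k) I)"
    and onto: "\<epsilon> ` free (Suc k) es = carrier (quotient_module (Suc k) I)"
    and min: "\<And>v j. v \<in> free (Suc k) es \<Longrightarrow> \<epsilon> v = I \<Longrightarrow> j < length es \<Longrightarrow> v j \<in> irrelevant_ideal (Suc k)"
  shows "es = [0]" "a_kernel (free_mod (Suc k) es) (quotient_module (Suc k) I) \<epsilon> = I_vec"
proof -
  interpret Q: homogeneous_ideal "Suc k" "I :: 'k mpoly set" by (rule homogeneous_ideal_I)
  let ?F = "free (Suc k) es :: (nat \<Rightarrow> 'k mpoly) set"
  note F = graded_submoduleD[OF graded_submodule_free[of "Suc k" es, where ?'a = 'k]]
  have add: "\<epsilon> (u + v) = \<epsilon> u \<oplus>\<^bsub>Q.M\<^esub> \<epsilon> v" if "u \<in> ?F" "v \<in> ?F" for u v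
    using \<epsilon> that by (simp add: graded_hom_def)
  have scal: "\<epsilon> (scal p u) = p \<odot>\<^bsub>Q.M\<^esub> \<epsilon> u" if "p \<in> polys (Suc k)" "u \<in> ?F" for p u
    using \<epsilon> that by (simp add: graded_hom_def)
  have comb: "\<epsilon> (scal p u + scal q v) = Q.coset (p * p' + q * q')"
    if "p \<in> polys (Suc k)" "q \<in> polys (Suc k)" "u \<in> ?F" "v \<in> ?F" "p' \<in> polys (Suc k)" "q' \<in> polys (Suc k)"
      "\<epsilon> u = Q.coset p'" "\<epsilon> v = Q.coset q'" for p q u v p' q'
    using that F(4) by (simp add: add scal Q.M_smult Q.M_add polys_mult)
  have no_unit: "Poly_Mapping.lookup (v j) 0 = 0" if "v \<in> ?F" "\<epsilon> v = I" "j < length es" for v j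
    using min[OF that] by (simp add: in_irrelevant_ideal_iff)
  have one_notin: "1 \<notin> (I :: 'k mpoly set)" using I_const_coeff[of 1] by auto
  obtain v1 where v1: "v1 \<in> ?F" "\<epsilon> v1 = Q.coset 1"
  proof -
    have "Q.coset 1 \<in> \<epsilon> ` ?F" unfolding onto Q.M_carrier by auto
    then show ?thesis using that by auto
  qed
  have unit: "unit_vec j 1 \<in> ?F" if "j < length es" for j using that by (intro unit_vec_free) auto
  have basis: "es ! j = 0 \<and> (\<exists>c. c \<noteq> 0 \<and> \<epsilon> (unit_vec j 1) = Q.coset (Poly_Mapping.single 0 c))"
    if j: "j < length es" for j
  proof -
    let ?b = "unit_vec j 1 :: nat \<Rightarrow> 'k mpoly"
    have "?b \<in> free_mod_deg (Suc k) es (es ! j)"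
      using const_mpoly_deg[of 1 "Suc k"] unit[OF j] by (auto simp: in_free_deg_iff unit_vec_def)
    then have "\<epsilon> ?b \<in> quotient_deg (Suc k) I (es ! j)"
      using \<epsilon> unfolding graded_hom_def by blast
    then obtain p where p: "p \<in> mpoly_deg (Suc k) (es ! j)" "\<epsilon> ?b = Q.coset p"
      by (auto simp: quotient_deg_def)
    then have pP: "p \<in> polys (Suc k)" by (simp add: in_mpoly_deg_iff)
    \<comment> \<open>A relation in which \<open>?b\<close> has coefficient \<open>1\<close>.\<close>
    have "\<epsilon> (scal 1 ?b + scal (- p) v1) = Q.coset (1 * p + (- p) * 1)"
      using pP by (intro comb unit[OF j] v1 p(2)) auto
    then have "\<epsilon> (scal 1 ?b + scal (- p) v1) = I" by (simp add: Q.coset_0)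
    moreover have "scal 1 ?b + scal (- p) v1 \<in> ?F"
      using pP unit[OF j] v1(1) by (intro F(3) F(4)) auto
    ultimately have "Poly_Mapping.lookup ((scal 1 ?b + scal (- p) v1) j) 0 = 0"
      using no_unit j by blast
    then have unit_coeff: "Poly_Mapping.lookup p 0 \<noteq> 0"
      by (auto simp: plus_fun_apply scal_def unit_vec_def lookup_minus const_coeff_mult)
    then have "0 \<in> Poly_Mapping.keys p" by (simp add: in_keys_iff)
    then have "es ! j = int (total_degree 0)" using p(1) unfolding in_mpoly_deg_iff by metis
    then have "es ! j = 0" by simp
    moreover from this have "p = Poly_Mapping.single 0 (Poly_Mapping.lookup p 0)"
      using hcomp_of_deg[OF p(1), of 0] hcomp_zero_degree[of p] by simp
    ultimately show ?thesis using p(2) unit_coeff by metis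
  qed
  have "es \<noteq> []"
  proof
    assume "es = []"
    then have "v1 = 0" using v1(1) by (auto simp: in_free_iff zero_fun_apply)
    then have "scal 0 v1 = v1" by (simp add: scal_simps)
    moreover have "\<epsilon> (scal 0 v1) = Q.coset 0"
      using scal[of 0 v1] v1 by (simp add: Q.M_smult)
    ultimately have "Q.coset 1 = Q.coset 0" using v1(2) by simp
    then show False using one_notin by (simp only: Q.coset_eq_iff) simp
  qed
  moreover have "\<not> 1 < length es"
  proof
    assume l: "1 < length es"
    then have "0 < length es" by linarith
    from basis[OF this] basis[OF l] obtain c0 c1 where c: "c0 \<noteq> 0" "c1 \<noteq> 0"
      "\<epsilon> (unit_vec 0 1) = Q.coset (Poly_Mapping.single 0 c0)" "\<epsilon> (unit_vec 1 1) = Q.coset (Poly_Mapping.single 0 c1)"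
      by blast
    let ?v = "scal (Poly_Mapping.single 0 c1) (unit_vec 0 1) + scal (Poly_Mapping.single 0 (- c0)) (unit_vec 1 1)"
    have "\<epsilon> ?v = Q.coset (Poly_Mapping.single 0 c1 * Poly_Mapping.single 0 c0
        + Poly_Mapping.single 0 (- c0) * Poly_Mapping.single 0 c1)"
      by (intro comb unit c(3,4) polys_const l \<open>0 < length es\<close>)
    then have "\<epsilon> ?v = I" by (simp add: mult_single mult.commute Q.coset_0 flip: single_add)
    moreover have "?v \<in> ?F" by (intro F(3) F(4) unit l \<open>0 < length es\<close> polys_const)
    ultimately have "Poly_Mapping.lookup (?v 0) 0 = 0" using no_unit \<open>0 < length es\<close> by blast
    then show False using c(2) by (simp add: plus_fun_apply scal_def unit_vec_def)
  qed
  ultimately have "length es = 1" by (metis One_nat_def length_0_conv less_one linorder_neqE_nat)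
  with basis[of 0] show es: "es = [0]" by (auto simp: length_Suc_conv)
  obtain c where c: "c \<noteq> 0" "\<epsilon> (unit_vec 0 1) = Q.coset (Poly_Mapping.single 0 c)"
    using basis[of 0] es by auto
  have "\<epsilon> v = I \<longleftrightarrow> v 0 \<in> I" if v: "v \<in> ?F" for v
  proof -
    have v0: "v 0 \<in> polys (Suc k)" using free_coord[OF v] .
    have "v = scal (v 0) (unit_vec 0 1)"
      using v es by (auto simp: fun_eq_iff scal_def unit_vec_def in_free_iff)
    then have "\<epsilon> v = Q.coset (v 0 * Poly_Mapping.single 0 c)"
      using scal[OF v0 unit[of 0]] es Q.M_smult[OF v0 polys_const] c(2) by simp
    then have *: "\<epsilon> v = I \<longleftrightarrow> Poly_Mapping.single 0 c * v 0 \<in> I"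
      by (simp add: Q.coset_eq_zero_iff mult.commute)
    have "v 0 \<in> I" if "Poly_Mapping.single 0 c * v 0 \<in> I"
      using Q.I_mult[OF that polys_const[of "inverse c"]] c(1) by (simp add: mult_single flip: mult.assoc)
    then show ?thesis using * Q.I_mult[OF _ polys_const] by blast
  qed
  then show "a_kernel (free_mod (Suc k) es) (quotient_module (Suc k) I) \<epsilon> = I_vec"
    by (auto simp: a_kernel_def' I_vec_def Q.M_zero es)
qed

text \<open>The set of the numbers \<open>Max (set (es i)) - i\<close> is \<open>{0, 1}\<close>: the module \<open>F\<^sub>0\<close> contributes \<open>0\<close>, and
every later nonzero \<open>F\<^sub>i\<close> contributes \<open>1\<close>.\<close>

lemma resolution_regularity:
  assumes res: "minimal_graded_free_resolution (Suc k) (quotient_module (Suc k) (I :: 'k::field mpoly set))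
    (quotient_deg (Suc k) I) es \<epsilon> \<delta>"
  shows "Max {Max (set (es i)) - int i | i. es i \<noteq> []} = 1"
proof -
  interpret Q: homogeneous_ideal "Suc k" "I :: 'k mpoly set" by (rule homogeneous_ideal_I)
  note R = res[unfolded minimal_graded_free_resolution_def]
  have ker: "{u \<in> free (Suc k) (es (Suc i)). \<delta> i u = 0} = \<delta> (Suc i) ` free (Suc k) (es (Suc (Suc i)))" for i
    using R unfolding graded_hom_kernel_eq by blast
  have irr: "\<delta> i v j \<in> irrelevant_ideal (Suc k)" if "v \<in> free (Suc k) (es (Suc i))" "j < length (es i)" for i v j
    using R that by blast
  have ker0: "a_kernel (free_mod (Suc k) (es 0)) (quotient_module (Suc k) I) \<epsilon> = \<delta> 0 ` free (Suc k) (es 1)"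
    using R by blast
  have "v j \<in> irrelevant_ideal (Suc k)" if "v \<in> free (Suc k) (es 0)" "\<epsilon> v = I" "j < length (es 0)" for v j
  proof -
    have "v \<in> \<delta> 0 ` free (Suc k) (es 1)"
      using that unfolding ker0[symmetric] by (simp add: a_kernel_def' Q.M_zero)
    then show ?thesis using irr[of _ 0 j] that(3) by auto
  qed
  note min = this
  have \<epsilon>: "\<epsilon> \<in> graded_hom (Suc k) (free_mod (Suc k) (es 0)) (free_mod_deg (Suc k) (es 0)) Q.M (quotient_deg (Suc k) I)"
    and onto: "\<epsilon> ` free (Suc k) (es 0) = carrier Q.M"
    and hom: "\<And>i. \<delta> i \<in> graded_hom (Suc k) (free_mod (Suc k) (es (Suc i))) (free_mod_deg (Suc k) (es (Suc i)))
      (free_mod (Suc k) (es i)) (free_mod_deg (Suc k) (es i))"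
    using R by auto
  have es0: "es 0 = [0]" by (rule augmentation_minimal(1)[OF \<epsilon> onto]) (rule min)
  have kI: "\<delta> 0 ` free (Suc k) (es 1) = I_vec"
    unfolding ker0[symmetric] by (rule augmentation_minimal(2)[OF \<epsilon> onto]) (rule min)
  have cover: "minimal_cover (es (Suc i)) (es i) (\<delta> i ` free (Suc k) (es (Suc i))) (\<delta> i)" for i
  proof -
    have "v j \<in> irrelevant_ideal (Suc k)" if "v \<in> free (Suc k) (es (Suc i))" "\<delta> i v = 0" "j < length (es (Suc i))" for v j
    proof -
      have "v \<in> \<delta> (Suc i) ` free (Suc k) (es (Suc (Suc i)))" using that ker[of i] by blast
      then show ?thesis using irr that(3) by blast
    qed
    then show ?thesis using hom[of i] by (simp add: minimal_cover_def)
  qed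
  have deg: "set (es (Suc i)) \<subseteq> {2 + int i}" for i
  proof (rule linear_resolution_degrees)
    show "linear_submodule 2 (es 0) I_vec" using linear_submodule_I_vec es0 by simp
    show "minimal_cover (es 1) (es 0) I_vec (\<delta> 0)" using cover[of 0] kI by simp
    show "minimal_cover (es (Suc (Suc i))) (es (Suc i)) {u \<in> free (Suc k) (es (Suc i)). \<delta> i u = 0} (\<delta> (Suc i))" for i
      using cover[of "Suc i"] ker by simp
  qed
  have Max_Suc: "Max (set (es (Suc i))) - int (Suc i) = 1" if "es (Suc i) \<noteq> []" for i
  proof -
    have "set (es (Suc i)) = {2 + int i}" using deg[of i] that by (metis set_empty subset_singletonD)
    then show ?thesis by simp
  qed
  have es1: "es 1 \<noteq> []"
  proof
    assume "es 1 = []"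
    then have "free (Suc k) (es 1) = {0 :: nat \<Rightarrow> 'k mpoly}" by (auto simp: in_free_iff zero_fun_apply fun_eq_iff)
    moreover have "\<delta> 0 0 = 0"
      using hom[of 0] by (rule graded_hom_freeD(5))
    ultimately show False using kI I_vec_nonzero[where ?'k = 'k] by auto
  qed
  have "{Max (set (es i)) - int i | i. es i \<noteq> []} = {0, 1}"
  proof (intro equalityI subsetI)
    fix x assume "x \<in> {Max (set (es i)) - int i | i. es i \<noteq> []}"
    then obtain i where i: "x = Max (set (es i)) - int i" "es i \<noteq> []" by blast
    then show "x \<in> {0, 1}" using es0 Max_Suc by (cases i) simp_all
  next
    have "0 = Max (set (es 0)) - int 0" "es 0 \<noteq> []" "1 = Max (set (es 1)) - int 1"
      using es0 es1 Max_Suc[of 0] by simp_all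
    moreover fix x :: int assume "x \<in> {0, 1}"
    ultimately show "x \<in> {Max (set (es i)) - int i | i. es i \<noteq> []}" using es1 by blast
  qed
  then show ?thesis by simp
qed

lemma resolution_exists:
  "\<exists>es \<epsilon> \<delta>. minimal_graded_free_resolution (Suc k) (quotient_module (Suc k) (I :: 'k::field mpoly set))
    (quotient_deg (Suc k) I) es \<epsilon> \<delta>"
proof -
  interpret Q: homogeneous_ideal "Suc k" "I :: 'k mpoly set" by (rule homogeneous_ideal_I)
  obtain es and \<delta> :: "nat \<Rightarrow> (nat \<Rightarrow> 'k mpoly) \<Rightarrow> (nat \<Rightarrow> 'k mpoly)"
    where es0: "es 0 = [0]" and cover0: "minimal_cover (es 1) (es 0) I_vec (\<delta> 0)"
    and cover: "\<And>i. minimal_cover (es (Suc (Suc i))) (es (Suc i)) {u \<in> free (Suc k) (es (Suc i)). \<delta> i u = 0} (\<delta> (Suc i))"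
    by (rule linear_resolution_exists[OF linear_submodule_I_vec[where ?'k = 'k]]) blast
  define \<epsilon> where "\<epsilon> v = Q.coset (v 0)" for v :: "nat \<Rightarrow> 'k mpoly"
  have v0: "v 0 \<in> polys (Suc k)" if "v \<in> free (Suc k) (es 0)" for v :: "nat \<Rightarrow> 'k mpoly"
    using free_coord[OF that] .
  have aug: "\<epsilon> \<in> graded_hom (Suc k) (free_mod (Suc k) (es 0)) (free_mod_deg (Suc k) (es 0)) Q.M (quotient_deg (Suc k) I)"
    unfolding graded_hom_def using v0
    by (auto simp: \<epsilon>_def Q.M_carrier Q.M_add Q.M_smult plus_fun_apply scal_def quotient_deg_def es0 in_free_deg_iff)
  have onto: "\<epsilon> ` free (Suc k) (es 0) = carrier Q.M"
  proof (intro equalityI subsetI)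
    fix x assume "x \<in> carrier Q.M"
    then obtain p where p: "p \<in> polys (Suc k)" "x = Q.coset p" by (auto simp: Q.M_carrier)
    have "unit_vec 0 p \<in> free (Suc k) (es 0)" using p(1) by (intro unit_vec_free) (simp_all add: es0)
    moreover have "x = \<epsilon> (unit_vec 0 p)" using p(2) by (simp add: \<epsilon>_def unit_vec_def)
    ultimately show "x \<in> \<epsilon> ` free (Suc k) (es 0)" by blast
  qed (use v0 in \<open>auto simp: \<epsilon>_def Q.M_carrier\<close>)
  have exact0: "a_kernel (free_mod (Suc k) (es 0)) Q.M \<epsilon> = \<delta> 0 ` free (Suc k) (es 1)"
    using cover0 by (simp add: minimal_cover_def a_kernel_def' Q.M_zero \<epsilon>_def Q.coset_eq_zero_iff I_vec_def es0)
  have hom: "\<delta> i \<in> graded_hom (Suc k) (free_mod (Suc k) (es (Suc i))) (free_mod_deg (Suc k) (es (Suc i)))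
      (free_mod (Suc k) (es i)) (free_mod_deg (Suc k) (es i))" for i
    using cover0 cover by (cases i) (simp_all add: minimal_cover_def)
  have exact: "a_kernel (free_mod (Suc k) (es (Suc i))) (free_mod (Suc k) (es i)) (\<delta> i) =
      \<delta> (Suc i) ` free (Suc k) (es (Suc (Suc i)))" for i
    using cover[of i] by (simp add: minimal_cover_def graded_hom_kernel_eq)
  have minimal: "\<delta> i v j \<in> irrelevant_ideal (Suc k)" if v: "v \<in> free (Suc k) (es (Suc i))" and j: "j < length (es i)" for i v j
  proof (cases i)
    case 0
    then have "\<delta> i v \<in> I_vec" using cover0 v by (auto simp: minimal_cover_def)
    then have "\<delta> i v 0 \<in> I" by (simp add: I_vec_def)
    then show ?thesis using j 0 I_const_coeff by (simp add: es0 in_irrelevant_ideal_iff in_I_iff)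
  next
    case (Suc i')
    have "\<delta> i v \<in> {u \<in> free (Suc k) (es (Suc i')). \<delta> i' u = 0}"
      using cover[of i'] v Suc by (auto simp: minimal_cover_def)
    moreover have "w j \<in> irrelevant_ideal (Suc k)" if "w \<in> free (Suc k) (es (Suc i'))" "\<delta> i' w = 0" for w
      using cover0 cover that j Suc by (cases i') (auto simp: minimal_cover_def)
    ultimately show ?thesis by blast
  qed
  have "minimal_graded_free_resolution (Suc k) Q.M (quotient_deg (Suc k) I) es \<epsilon> \<delta>"
    unfolding minimal_graded_free_resolution_def
    by (intro conjI allI ballI impI Q.graded_module_M aug hom onto exact0 exact minimal)
  then show ?thesis by blast
qed

lemma regularity_I:
  "regularity (Suc k) (quotient_module (Suc k) (I :: 'k::field mpoly set)) (quotient_deg (Suc k) I) = 1"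
  unfolding regularity_def
proof (rule the_equality)
  obtain es \<epsilon> \<delta> where res: "minimal_graded_free_resolution (Suc k) (quotient_module (Suc k) (I :: 'k mpoly set)) (quotient_deg (Suc k) I) es \<epsilon> \<delta>"
    using resolution_exists by blast
  show "\<exists>es \<epsilon> \<delta>. minimal_graded_free_resolution (Suc k) (quotient_module (Suc k) (I :: 'k mpoly set)) (quotient_deg (Suc k) I) es \<epsilon> \<delta> \<and>
      1 = Max {Max (set (es i)) - int i | i. es i \<noteq> []}"
    by (intro exI conjI) (rule res, rule resolution_regularity[OF res, symmetric])
next
  fix r
  assume "\<exists>es \<epsilon> \<delta>. minimal_graded_free_resolution (Suc k) (quotient_module (Suc k) (I :: 'k mpoly set)) (quotient_deg (Suc k) I) es \<epsilon> \<delta> \<and>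
      r = Max {Max (set (es i)) - int i | i. es i \<noteq> []}"
  then show "r = 1" by (elim exE conjE) (simp only: resolution_regularity)
qed

end

theorem corollary6p4:
  fixes K :: "'k::field itself" and a d :: "nat ^ 2" and k :: nat
  assumes "k \<ge> 2"
    and "lin_indep_over_rat a d"
    and "minimal_generating_set (arith_gen a d ` {..k}) (arith_semigroup a d k)"
  shows "arith_semigroup_ring_regularity K a d k = 1"
proof -
  interpret arith_toric a d k
    using assms(1) lin_indep_over_rat_cancel[OF assms(2)] by unfold_locales
  show ?thesis
    unfolding arith_semigroup_ring_regularity_def Let_def Suc_eq_plus1[symmetric] by (rule regularity_I)
qed

end
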